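(* Let $q$ be an odd prime power. Every Bierbrauer presemifield of order $q^4$ (i.e. with $m=1$) is isotopic to a Dickson semifield. Every Bierbrauer presemifield of order $q^{4m}$ with $m>1$ odd is isotopic neither to a Dickson semifield, nor to a Generalized twisted field, nor to any of the following known commutative presemifields of characteristic $3$: Ganley semifields, Cohen--Ganley semifields, Coulter--Matthews/Ding--Yuan presemifields, the Penttila--Williams/Bader--Lunardon--Pinneri semifield, the Coulter--Henderson--Kosick presemifield.
   Context: A finite semifield $(S,+,\star)$ satisfies all axioms of a skewfield except possibly associativity of multiplication; a presemifield satisfies all axioms of a semifield except possibly existence of a multiplicative identity. The additive group of a finite presemifield is an elementary abelian $p$-group for some prime $p$, called its characteristic. Presemifields $(S,+,\star)$, $(S',+,\star')$ of characteristic $p$ are isotopic if there are invertible $\mathbb{F}_p$-linear maps $g_1,g_2,g_3:S\to S'$ with $g_1(x)\star' g_2(y)=g_3(x\star y)$ for all $x,y\in S$. Bierbrauer presemifields of order $q^{4m}$: $(\mathbb{F}_{q^{4m}},+,\star)$, $q$ an odd prime power, with $x\star y=y^{q^n}x+yx^{q^n}-v(y^{q^{m+n}}x^{q^{3m}}+y^{q^{3m}}x^{q^{m+n}})$, where $v=u^{q^m-1}$, $u$ is a primitive element of $\mathbb{F}_{q^{4m}}$, $0<n<4m$, $\gcd(m,n)=1$, $\frac{2m}{\gcd(2m,n)}$ is odd and $q^m\equiv q^n\equiv1\pmod4$. Dickson semifields: $(\mathbb{F}_{q^k}\times\mathbb{F}_{q^k},+,\star)$, $q$ an odd prime power, $k>1$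 odd, $(a,b)\star(c,d)=(ac+jb^\sigma d^\sigma,ad+bc)$, $j$ a nonsquare in $\mathbb{F}_{q^k}$, $\sigma\neq\mathrm{id}$ an $\mathbb{F}_q$-automorphism of $\mathbb{F}_{q^k}$. (Commutative) Generalized twisted fields: $(\mathbb{F}_{q^t},+,\star)$, $q$ an odd prime power, $t>1$ odd, $x\star y=x^\alpha y+xy^\alpha$, where $\alpha:x\mapsto x^{q^n}$ is an automorphism of $\mathbb{F}_{q^t}$ with fixed field $\mathbb{F}_q$ and $\frac{t}{\gcd(t,n)}$ odd. Ganley semifields: $(\mathbb{F}_{3^r}\times\mathbb{F}_{3^r},+,\star)$, $r\ge3$ odd, $(a,b)\star(c,d)=(ac-b^9d-bd^9,ad+bc+b^3d^3)$. Cohen--Ganley semifields: $(\mathbb{F}_{3^s}\times\mathbb{F}_{3^s},+,\star)$, $s\ge3$, $(a,b)\star(c,d)=(ac+jbd+j^3(bd)^9,ad+bc+j(bd)^3)$, $j$ a nonsquare in $\mathbb{F}_{3^s}$. Coulter--Matthews/Ding--Yuan presemifields: $(\mathbb{F}_{3^e},+,\star)$, $e\ge3$ odd, $x\star y=x^9y+xy^9\pm2x^3y^3-2xy$. Penttila--Williams/Bader--Lunardon--Pinneri semifield: $(\mathbb{F}_{3^5}\times\mathbb{F}_{3^5},+,\star)$, $(a,b)\star(c,d)=(ac+(bd)^9,ad+bc+(bd)^{27})$. Coulter--Henderson--Kosick presemifield: $(\mathbb{F}_{3^8},+,\star)$, $x\star y=xy+L(xy^9+x^9y-xy-x^9y^9)+x^{243}y^3+x^{81}y-x^9y+x^3y^{243}+xy^{81}-xy^9$,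 with $L(x)=x^{3^5}+x^{3^2}$.
   Formalization: Dickson semifields are taken with any k > 1 rather than k > 1 odd; with k odd the first sentence fails, e.g. for q = 5, m = 1, n = 2, since a Dickson semifield of order 5^4 must have k = 2. *)

theory Defs
  imports
    "HOL-Library.Product_Plus"
    "HOL-Number_Theory.Number_Theory"
begin

section \<open>Presemifields and isotopy\<close>

text \<open>
  A presemifield is given by its carrier and its multiplication. The addition is that of the
  surrounding type; it is componentwise on pairs.
\<close>

type_synonym 'a presemifield = "'a set \<times> ('a \<Rightarrow> 'a \<Rightarrow> 'a)"

definition additive_characteristic :: "nat \<Rightarrow> 'a::comm_monoid_add set \<Rightarrow> bool" where
  "additive_characteristic p S \<longleftrightarrow> prime p \<and> (\<forall>x\<in>S. (\<Sum>i<p. x) = 0)"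

text \<open>
  The scalar $c \in \{0, \ldots, p-1\}$ of the prime field with $p$ elements acts on an elementary
  abelian $p$-group as $c$-fold addition.
\<close>

definition prime_field_linear_on ::
    "nat \<Rightarrow> 'a::comm_monoid_add set \<Rightarrow> ('a \<Rightarrow> 'b::comm_monoid_add) \<Rightarrow> bool" where
  "prime_field_linear_on p S g \<longleftrightarrow>
     (\<forall>x\<in>S. \<forall>y\<in>S. g (x + y) = g x + g y) \<and>
     (\<forall>c<p. \<forall>x\<in>S. g (\<Sum>i<c. x) = (\<Sum>i<c. g x))"

definition isotopic ::
    "'a::comm_monoid_add presemifield \<Rightarrow> 'b::comm_monoid_add presemifield \<Rightarrow> bool" where
  "isotopic A B \<longleftrightarrow>
     (case A of (S, mul) \<Rightarrow> case B of (S', mul') \<Rightarrow>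
       \<exists>p. additive_characteristic p S \<and> additive_characteristic p S' \<and>
         (\<exists>g1 g2 g3.
            (\<forall>g\<in>{g1, g2, g3}. bij_betw g S S' \<and> prime_field_linear_on p S g) \<and>
            (\<forall>x\<in>S. \<forall>y\<in>S. mul' (g1 x) (g2 y) = g3 (mul x y))))"


section \<open>Finite fields\<close>

text \<open>
  The finite field with $N$ elements is represented by any subfield of order $N$ of any
  type of class \<open>field\<close>. The subfield may be all of the type, and the surrounding field need not
  be finite.
\<close>

definition finite_field_of_order :: "'a::field set \<Rightarrow> nat \<Rightarrow> bool" where
  "finite_field_of_order K N \<longleftrightarrow>
     finite K \<and> card K = N \<and> 0 \<in> K \<and> 1 \<in> K \<and>
     (\<forall>x\<in>K. \<forall>y\<in>K. x + y \<in> K \<and> x - y \<in> K \<and> x * y \<in> K) \<and>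
     (\<forall>x\<in>K. inverse x \<in> K)"

definition primitive_element :: "'a::field set \<Rightarrow> 'a \<Rightarrow> bool" where
  "primitive_element K u \<longleftrightarrow> range (\<lambda>i::nat. u ^ i) = K - {0}"

definition nonsquare_in :: "'a::field set \<Rightarrow> 'a \<Rightarrow> bool" where
  "nonsquare_in K j \<longleftrightarrow> j \<in> K \<and> \<not> (\<exists>z\<in>K. j = z ^ 2)"

definition field_automorphism_on :: "'a::field set \<Rightarrow> ('a \<Rightarrow> 'a) \<Rightarrow> bool" where
  "field_automorphism_on K \<sigma> \<longleftrightarrow>
     bij_betw \<sigma> K K \<and>
     (\<forall>x\<in>K. \<forall>y\<in>K. \<sigma> (x + y) = \<sigma> x + \<sigma> y \<and> \<sigma> (x * y) = \<sigma> x * \<sigma> y)"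

definition odd_prime_power :: "nat \<Rightarrow> bool" where
  "odd_prime_power q \<longleftrightarrow> odd q \<and> primepow q"


section \<open>The families of commutative presemifields\<close>

definition bierbrauer_presemifield :: "nat \<Rightarrow> nat \<Rightarrow> 'a::field presemifield \<Rightarrow> bool" where
  "bierbrauer_presemifield q m B \<longleftrightarrow>
     odd_prime_power q \<and>
     (\<exists>K n u v.
        finite_field_of_order K (q ^ (4 * m)) \<and>
        primitive_element K u \<and> v = u ^ (q ^ m - 1) \<and>
        0 < n \<and> n < 4 * m \<and> gcd m n = 1 \<and> odd (2 * m div gcd (2 * m) n) \<and>
        [q ^ m = 1] (mod 4) \<and> [q ^ n = 1] (mod 4) \<and>
        B = (K, \<lambda>x y. y ^ (q ^ n) * x + y * x ^ (q ^ n)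
                  - v * (y ^ (q ^ (m + n)) * x ^ (q ^ (3 * m))
                         + y ^ (q ^ (3 * m)) * x ^ (q ^ (m + n)))))"

text \<open>
  For Dickson semifields every exponent $k > 1$ is allowed, not only odd $k$: a Dickson semifield
  of order $p^4$, $p$ prime, has $k = 2$, and the Bierbrauer presemifields of order $p^4$ are
  isotopic to such semifields.
\<close>

definition dickson_semifield :: "('a::field \<times> 'a) presemifield \<Rightarrow> bool" where
  "dickson_semifield D \<longleftrightarrow>
     (\<exists>q k K F j \<sigma>.
        odd_prime_power q \<and> k > 1 \<and>
        finite_field_of_order K (q ^ k) \<and>
        finite_field_of_order F q \<and> F \<subseteq> K \<and>
        nonsquare_in K j \<and>
        field_automorphism_on K \<sigma> \<and> (\<forall>x\<in>F. \<sigma> x = x) \<and> (\<exists>x\<in>K. \<sigma> x \<noteq> x) \<and>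
        D = (K \<times> K, \<lambda>(a, b) (c, d). (a * c + j * \<sigma> b * \<sigma> d, a * d + b * c)))"

definition generalized_twisted_field :: "'a::field presemifield \<Rightarrow> bool" where
  "generalized_twisted_field T \<longleftrightarrow>
     (\<exists>q t n K \<alpha>.
        odd_prime_power q \<and> t > 1 \<and> odd t \<and> odd (t div gcd t n) \<and>
        finite_field_of_order K (q ^ t) \<and>
        \<alpha> = (\<lambda>x. x ^ (q ^ n)) \<and>
        field_automorphism_on K \<alpha> \<and> finite_field_of_order {x\<in>K. \<alpha> x = x} q \<and>
        T = (K, \<lambda>x y. \<alpha> x * y + x * \<alpha> y))"

definition ganley_semifield :: "('a::field \<times> 'a) presemifield \<Rightarrow> bool" where
  "ganley_semifield G \<longleftrightarrow>
     (\<exists>r K.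
        r \<ge> 3 \<and> odd r \<and> finite_field_of_order K (3 ^ r) \<and>
        G = (K \<times> K, \<lambda>(a, b) (c, d).
               (a * c - b ^ 9 * d - b * d ^ 9, a * d + b * c + b ^ 3 * d ^ 3)))"

definition cohen_ganley_semifield :: "('a::field \<times> 'a) presemifield \<Rightarrow> bool" where
  "cohen_ganley_semifield G \<longleftrightarrow>
     (\<exists>s K j.
        s \<ge> 3 \<and> finite_field_of_order K (3 ^ s) \<and> nonsquare_in K j \<and>
        G = (K \<times> K, \<lambda>(a, b) (c, d).
               (a * c + j * b * d + j ^ 3 * (b * d) ^ 9, a * d + b * c + j * (b * d) ^ 3)))"

definition coulter_matthews_ding_yuan_presemifield :: "'a::field presemifield \<Rightarrow> bool" where
  "coulter_matthews_ding_yuan_presemifield P \<longleftrightarrow>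
     (\<exists>e K s.
        e \<ge> 3 \<and> odd e \<and> finite_field_of_order K (3 ^ e) \<and> s \<in> {1, -1} \<and>
        P = (K, \<lambda>x y. x ^ 9 * y + x * y ^ 9 + s * (2 * x ^ 3 * y ^ 3) - 2 * x * y))"

definition penttila_williams_semifield :: "('a::field \<times> 'a) presemifield \<Rightarrow> bool" where
  "penttila_williams_semifield P \<longleftrightarrow>
     (\<exists>K.
        finite_field_of_order K (3 ^ 5) \<and>
        P = (K \<times> K, \<lambda>(a, b) (c, d).
               (a * c + (b * d) ^ 9, a * d + b * c + (b * d) ^ 27)))"

definition coulter_henderson_kosick_presemifield :: "'a::field presemifield \<Rightarrow> bool" where
  "coulter_henderson_kosick_presemifield P \<longleftrightarrow>
     (\<exists>K L.
        finite_field_of_order K (3 ^ 8) \<and>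
        L = (\<lambda>x. x ^ (3 ^ 5) + x ^ (3 ^ 2)) \<and>
        P = (K, \<lambda>x y. x * y + L (x * y ^ 9 + x ^ 9 * y - x * y - x ^ 9 * y ^ 9)
                  + x ^ 243 * y ^ 3 + x ^ 81 * y - x ^ 9 * y
                  + x ^ 3 * y ^ 243 + x * y ^ 81 - x * y ^ 9))"

end

theory Submission
  imports Defs "HOL-Computational_Algebra.Polynomial"
begin

text \<open>
  \<^emph>\<open>Order $q^4$.\<close> For $m = 1$ the conditions on $n$ leave only $n = 2$, and the product is
  $x \star y = (x y^{q^2} + x^{q^2} y) - 2 v (x y)^{q^3}$: a form with values in the subfield
  $L$ of order $q^2$, plus a twisted copy of the field product. Choose $\omega$ with
  $\omega^{q^2} = -\omega$ and write $x = a + b \omega$ and $y = c + d \omega$ with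
  $a, b, c, d \in L$. The trace form becomes
  $2 (a c - b d \omega^2)$, while $(x y)^{q^3}$ is the $q$-th power of
  $a c + b d \omega^2 - (a d + b c) \omega$. Multiplying $x$ and $y$ by suitable constants first
  turns $v$ into a fourth root of unity $\iota$, which lies in the field of order $q$ because
  $q \equiv 1$ modulo $4$. Then $A(z) = z - \iota z^q$ is bijective on $L$, and the $L$-part of
  the product equals, up to a constant, $A(a c + j b^q d^q)$ with $j = -\iota \omega^{2q}$, while
  the remaining part is the $q$-th power of $a d + b c$, up to a constant. This is a Dickson
  product, and $j$ is a nonsquare of $L$ because one of its square roots is negated by
  $x \mapsto x^{q^2}$. The outcome is \<open>product_formula\<close>, from which \<open>isotopic_dickson\<close> follows.

  \<^emph>\<open>Order $q^{4m}$ with $m > 1$ odd.\<close> The invariant is the middle nucleus, in the form of the maps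
  $A$ for which there is a map $B$ with $A(x) \star y = x \star B(y)$ for all $x, y$. Isotopisms
  conjugate such maps into each other. For a Bierbrauer product, the left side is a
  combination of the Frobenius powers $y^{q^i}$ with $i$ in $E = \{0, n, m+n, 3m\}$ modulo $4m$,
  and the right side is a combination of the same powers of $x$. Taking coefficients with respect
  to $y$ therefore writes both $A(x)$ and $A(x)^{q^n}$ as combinations of the powers $x^{q^i}$ with
  $i \in E$, and then only the term with $i = 0$ can survive in $A$, because $0$ is the only
  element $i$ of $E$ with $i + n \in E$. So $A(x) = a x$, and comparing coefficients once more
  gives $a^{q^2} = a$ (\<open>middle_multiplier_bierbrauer\<close>): the middle nucleus has at most $q^2$
  elements.

  If a field of order $p^f$ acts by middle multipliers on a presemifield isotopic to this one and
  $q = p^e$, then every element $t$ of it satisfies $t^{q^2} = t$, hence $f$ divides $2 e$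
  (\<open>scalar_field_degree\<close>). In a Dickson or Cohen--Ganley semifield
  the field whose elements are the components acts in this way, and its order $q^{2m}$ is too
  large. In a generalized twisted field of odd dimension $t$ the fixed field acts so, and
  $f t = 4 m e$ contradicts $f \mid 2 e$, since $t$ is odd. The other families are excluded by
  their order alone: in characteristic $3$ the exponent of the order is divisible by $4 m$.
\<close>

section \<open>Finite subfields\<close>

lemma finite_field_mem:
  assumes "finite_field_of_order K N"
  shows "finite K" "card K = N" "0 \<in> K" "1 \<in> K"
    and "x \<in> K \<Longrightarrow> y \<in> K \<Longrightarrow> x + y \<in> K"
    and "x \<in> K \<Longrightarrow> y \<in> K \<Longrightarrow> x - y \<in> K"
    and "x \<in> K \<Longrightarrow> y \<in> K \<Longrightarrow> x * y \<in> K"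
    and "x \<in> K \<Longrightarrow> inverse x \<in> K"
    and "x \<in> K \<Longrightarrow> x ^ i \<in> K"
proof -
  show "x \<in> K \<Longrightarrow> x ^ i \<in> K"
    using assms by (induction i) (auto simp: finite_field_of_order_def)
qed (use assms in \<open>auto simp: finite_field_of_order_def\<close>)

lemma finite_field_order_gt_1:
  assumes "finite_field_of_order (K :: 'a::field set) N"
  shows "N > 1"
proof -
  note K = finite_field_mem[OF assms]
  have "card {0, 1 :: 'a} \<le> card K"
    using K(1,3,4) by (intro card_mono) auto
  then show ?thesis
    using K(2) by simp
qed

text \<open>Multiplication by \<open>x\<close> permutes the nonzero elements, so it does not change their product.\<close>

lemma finite_field_power_order_minus_1:
  assumes ff: "finite_field_of_order (K :: 'a::field set) N" and x: "x \<in> K" "x \<noteq> 0"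
  shows "x ^ (N - 1) = 1"
proof -
  note K = finite_field_mem[OF ff]
  have div: "y / x \<in> K" if "y \<in> K" for y
    using that x K(7,8) by (simp add: divide_inverse)
  define P where "P = (\<Prod>y\<in>K - {0}. y)"
  have "P = (\<Prod>y\<in>K - {0}. x * y)"
    unfolding P_def
    by (rule prod.reindex_bij_witness[of _ "\<lambda>y. x * y" "\<lambda>y. y / x"]) (use x K(7) div in auto)
  also have "\<dots> = x ^ (N - 1) * P"
    using K(1,2,3) by (simp add: prod.distrib P_def card_Diff_singleton)
  finally show ?thesis
    using K(1) by (simp add: P_def)
qed

lemma finite_field_power_order:
  assumes ff: "finite_field_of_order (K :: 'a::field set) N" and x: "x \<in> K"
  shows "x ^ N = x"
proof (cases "x = 0")
  case False
  have "x ^ N = x ^ (N - 1) * x"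
    using finite_field_order_gt_1[OF ff] by (metis power_minus_mult gr_implies_not0 neq0_conv)
  then show ?thesis
    using finite_field_power_order_minus_1[OF ff x False] by simp
qed (use finite_field_order_gt_1[OF ff] in auto)

text \<open>
  The translation by 1 permutes the field and does not change the sum of its elements; the sum of
  as many ones as there are elements is therefore 0.
\<close>

lemma finite_field_CHAR:
  assumes ff: "finite_field_of_order (K :: 'a::field set) (p ^ e)" and p: "prime p"
  shows "CHAR('a) = p"
proof -
  note K = finite_field_mem[OF ff]
  have "(\<Sum>x\<in>K. x) = (\<Sum>x\<in>K. x + 1)"
    by (rule sum.reindex_bij_witness[of _ "\<lambda>y. y + 1" "\<lambda>y. y - 1"]) (use K(4-6) in auto)
  then have "of_nat (p ^ e) = (0 :: 'a)"
    using K(2) by (simp add: sum.distrib)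
  then have "of_nat p = (0 :: 'a)"
    by simp
  then have "CHAR('a) dvd p"
    by (simp add: of_nat_eq_0_iff_char_dvd)
  moreover have "CHAR('a) \<noteq> 1"
    using of_nat_CHAR[where 'a = 'a] by (metis of_nat_1 zero_neq_one)
  ultimately show ?thesis
    using p by (meson prime_nat_iff)
qed

lemma frobenius_add:
  assumes ff: "finite_field_of_order (K :: 'a::field set) (q ^ s)" and q: "primepow q"
  shows "(x + y :: 'a) ^ (q ^ i) = x ^ (q ^ i) + y ^ (q ^ i)"
    and "(x - y :: 'a) ^ (q ^ i) = x ^ (q ^ i) - y ^ (q ^ i)"
proof -
  obtain p e where pe: "prime p" "q = p ^ e"
    using q by (auto simp: primepow_def)
  have char: "CHAR('a) = p"
    using finite_field_CHAR[of K p "e * s"] ff pe by (simp add: power_mult)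
  have add: "(a + b :: 'a) ^ (q ^ i) = a ^ (q ^ i) + b ^ (q ^ i)" for a b
    by (rule freshmans_dream'[of _ "e * i"]) (auto simp: char pe power_mult)
  show "(x + y) ^ (q ^ i) = x ^ (q ^ i) + y ^ (q ^ i)"
    by (rule add)
  show "(x - y) ^ (q ^ i) = x ^ (q ^ i) - y ^ (q ^ i)"
    using add[of "x - y" y] by (simp add: algebra_simps)
qed

text \<open>
  If \<open>a * k = b * l + gcd a b\<close>, then the power with exponent $q^{ak}$ and the power with exponent
  $q^{bl}$ both fix \<open>x\<close>, and the first is the power of the second with exponent $q^{\gcd(a, b)}$.
\<close>

lemma frobenius_fixed_gcd:
  fixes x :: "'a::monoid_mult"
  assumes a: "x ^ (q ^ a) = x" and b: "x ^ (q ^ b) = x"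
  shows "x ^ (q ^ gcd a b) = x"
proof (cases "a = 0")
  case False
  have iterate: "x ^ (q ^ (c * k)) = x" if "x ^ (q ^ c) = x" for c k
    using that by (induction k) (auto simp: power_add power_mult)
  from bezout_nat[OF False, of b] obtain k l where kl: "a * k = b * l + gcd a b"
    by blast
  have "x = x ^ (q ^ (b * l + gcd a b))"
    using iterate[OF a, of k] kl by simp
  also have "\<dots> = (x ^ (q ^ (b * l))) ^ (q ^ gcd a b)"
    by (simp add: power_add power_mult)
  finally show ?thesis
    by (simp add: iterate[OF b])
qed (use b in simp)

lemma card_frobenius_fixed_le:
  assumes "1 < (n::nat)"
  shows "finite {x :: 'a::field. x ^ n = x}" and "card {x :: 'a::field. x ^ n = x} \<le> n"
proof -
  define P :: "'a poly" where "P = monom 1 n - monom 1 1"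
  have roots: "{x. x ^ n = x} = {x. poly P x = 0}"
    by (auto simp: P_def poly_monom)
  have "coeff P n = 1"
    using assms by (simp add: P_def)
  then have "P \<noteq> 0"
    by auto
  moreover have "degree P \<le> n"
    unfolding P_def using assms
    by (intro degree_diff_le) (auto simp: degree_monom_le order_trans[OF degree_monom_le])
  ultimately show "finite {x :: 'a::field. x ^ n = x}" "card {x :: 'a::field. x ^ n = x} \<le> n"
    unfolding roots using card_poly_roots_bound[of P] poly_roots_finite[of P] by auto
qed

text \<open>
  By \<open>frobenius_fixed_gcd\<close> all of \<open>F\<close> consists of roots of $x^{p^d} - x$ with \<open>d = gcd f g\<close>, and
  this polynomial has too few roots unless \<open>d = f\<close>.
\<close>

lemma frobenius_fixes_subfield:
  fixes F :: "'a::field set"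
  assumes F: "finite_field_of_order F (p ^ f)" and p: "p > 1"
    and fixed: "\<And>t. t \<in> F \<Longrightarrow> t ^ (p ^ g) = t"
  shows "f dvd g"
proof -
  define d where "d = gcd f g"
  have "f > 0"
    using finite_field_order_gt_1[OF F] by (cases f) auto
  then have d: "d > 0" "d dvd f" "d dvd g"
    by (auto simp: d_def)
  have "F \<subseteq> {t. t ^ (p ^ d) = t}"
    using frobenius_fixed_gcd[OF finite_field_power_order[OF F] fixed] by (auto simp: d_def)
  moreover have "1 < p ^ d"
    using p d(1) by (rule one_less_power)
  ultimately have "card F \<le> p ^ d"
    using card_frobenius_fixed_le by (blast intro: order_trans card_mono)
  then have "f \<le> d"
    using p finite_field_mem(2)[OF F] by simp
  with d \<open>f > 0\<close> have "f = d"
    using dvd_imp_le[of d f] by simp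
  then show ?thesis
    using d(3) by simp
qed

lemma prime_power_root:
  fixes x p :: nat
  assumes p: "prime p" and x: "x ^ a = p ^ c" and a: "a > 0"
  obtains f where "x = p ^ f" "f * a = c"
proof -
  have "x dvd p ^ c"
    using a x by (metis dvd_power)
  then obtain f where f: "x = p ^ f"
    using divides_primepow_nat[OF p] by auto
  then have "f * a = c"
    using x p prime_gt_1_nat[OF p] by (simp flip: power_mult)
  then show ?thesis
    using f that by blast
qed

locale primitive_field =
  fixes K :: "'a::field set" and u :: 'a and q s :: nat
  assumes ff: "finite_field_of_order K (q ^ s)"
    and prim: "primitive_element K u"
    and q: "primepow q"
begin

lemmas mem = finite_field_mem[OF ff]
lemmas fadd = frobenius_add[OF ff q]

lemma q_gt_1: "q > 1"
  using primepow_gt_Suc_0[OF q] by simp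

lemma s_pos: "s > 0"
  using finite_field_order_gt_1[OF ff] by (cases s) auto

lemma u_mem: "u \<in> K - {0}"
proof -
  have "u ^ 1 \<in> range (\<lambda>i::nat. u ^ i)"
    by blast
  then show ?thesis
    using prim by (simp add: primitive_element_def)
qed

lemma u_power_mod: "u ^ i = u ^ (i mod (q ^ s - 1))"
proof -
  have "u ^ i = u ^ ((q ^ s - 1) * (i div (q ^ s - 1)) + i mod (q ^ s - 1))"
    by simp
  also have "\<dots> = u ^ (i mod (q ^ s - 1))"
    unfolding power_add power_mult using finite_field_power_order_minus_1[OF ff] u_mem by simp
  finally show ?thesis .
qed

lemma u_inj: "inj_on (\<lambda>i. u ^ i) {..<q ^ s - 1}"
proof (rule eq_card_imp_inj_on)
  have "q ^ s - 1 > 0"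
    using finite_field_order_gt_1[OF ff] by simp
  then have "(\<lambda>i. u ^ i) ` {..<q ^ s - 1} = K - {0}"
  proof -
    have "u ^ i \<in> (\<lambda>i. u ^ i) ` {..<q ^ s - 1}" for i
      using u_power_mod[of i] \<open>q ^ s - 1 > 0\<close> by (intro image_eqI[of _ _ "i mod (q ^ s - 1)"]) auto
    then have "(\<lambda>i. u ^ i) ` {..<q ^ s - 1} = range (\<lambda>i::nat. u ^ i)"
      by blast
    then show ?thesis
      using prim by (simp add: primitive_element_def)
  qed
  then show "card ((\<lambda>i. u ^ i) ` {..<q ^ s - 1}) = card {..<q ^ s - 1}"
    using mem(1,2,3) by (simp add: card_Diff_singleton)
qed simp

lemma u_power_eq_iff: "u ^ i = u ^ j \<longleftrightarrow> [i = j] (mod (q ^ s - 1))"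
proof -
  have "q ^ s - 1 > 0"
    using finite_field_order_gt_1[OF ff] by simp
  then have "u ^ (i mod (q ^ s - 1)) = u ^ (j mod (q ^ s - 1)) \<longleftrightarrow>
      i mod (q ^ s - 1) = j mod (q ^ s - 1)"
    using u_inj by (intro inj_on_eq_iff) auto
  then show ?thesis
    using u_power_mod[of i] u_power_mod[of j] by (simp add: cong_def)
qed

lemma frobenius_mod: "x \<in> K \<Longrightarrow> x ^ (q ^ i) = x ^ (q ^ (i mod s))"
proof -
  assume x: "x \<in> K"
  have iterate: "x ^ (q ^ (s * k)) = x" for k
    using finite_field_power_order[OF ff x] by (induction k) (auto simp: power_add power_mult)
  have "x ^ (q ^ i) = x ^ (q ^ (s * (i div s) + i mod s))"
    by simp
  also have "\<dots> = x ^ (q ^ (i mod s))"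
    by (simp only: power_add power_mult[of x] iterate)
  finally show ?thesis .
qed

lemma u_frobenius_eq_iff: "u ^ (q ^ i) = u ^ (q ^ j) \<longleftrightarrow> [i = j] (mod s)"
proof
  assume "[i = j] (mod s)"
  then show "u ^ (q ^ i) = u ^ (q ^ j)"
    using frobenius_mod[of u i] frobenius_mod[of u j] u_mem by (simp add: cong_def)
next
  assume eq: "u ^ (q ^ i) = u ^ (q ^ j)"
  define i' j' where "i' = i mod s" and "j' = j mod s"
  have lt: "i' < s" "j' < s"
    using s_pos by (auto simp: i'_def j'_def)
  \<comment> \<open>Distinct powers of $q$ below $q^s$ stay distinct modulo $q^s - 1$, except in the trivial case
    of modulus 1, where \<open>s = 1\<close>.\<close>
  have small: "q ^ k < q ^ s - 1 \<or> q ^ s = 2" if "k < s" for k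
  proof -
    have "q * q ^ k \<le> q ^ s"
      using that q_gt_1 power_increasing[of "Suc k" s q] by simp
    moreover have "2 * q ^ k \<le> q * q ^ k"
      using q_gt_1 by simp
    moreover have "q ^ k = 1 \<or> q ^ k \<ge> 2"
      using q_gt_1 self_le_power[of q k] by (cases "k = 0") auto
    ultimately show ?thesis
      by linarith
  qed
  have "u ^ (q ^ i') = u ^ (q ^ j')"
    using eq frobenius_mod[of u i] frobenius_mod[of u j] u_mem by (simp add: i'_def j'_def)
  then have cong: "[q ^ i' = q ^ j'] (mod (q ^ s - 1))"
    by (simp add: u_power_eq_iff)
  have "i' = j'"
  proof (cases "q ^ s = 2")
    case True
    then have "s \<le> 1"
      using q_gt_1 power_increasing[of 2 s q] power_mono[of 2 q 2] by force
    then show ?thesis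
      using lt by linarith
  next
    case False
    then have "q ^ i' = q ^ j'"
      using cong small[OF lt(1)] small[OF lt(2)] by (simp add: cong_def)
    then show ?thesis
      using q_gt_1 by simp
  qed
  then show "[i = j] (mod s)"
    by (simp add: cong_def i'_def j'_def)
qed

text \<open>
  The polynomial $x^{q^d} - x$ has at most $q^d$ roots. The element 0 and the powers of
  $u^M$ with $M = (q^s - 1) / (q^d - 1)$ are that many of them.
\<close>

lemma fixed_field:
  assumes d: "d dvd s" "d > 0"
  shows "finite_field_of_order {x \<in> K. x ^ (q ^ d) = x} (q ^ d)"
proof -
  let ?L = "{x \<in> K. x ^ (q ^ d) = x}"
  have qd: "q ^ d > 1"
    using q_gt_1 d(2) by (rule one_less_power)
  obtain k where k: "s = d * k"
    using d(1) by blast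
  have "[(q ^ d) ^ k = 1 ^ k] (mod (q ^ d - 1))"
    using qd by (intro cong_pow) (simp add: cong_def le_mod_geq)
  then have "q ^ d - 1 dvd q ^ s - 1"
    using cong_to_1_nat[of "(q ^ d) ^ k" "q ^ d - 1"] by (simp add: k power_mult)
  then obtain M where M: "q ^ s - 1 = (q ^ d - 1) * M"
    by blast
  have M_pos: "M > 0"
    using M finite_field_order_gt_1[OF ff] by (cases M) auto
  have "(u ^ (M * i)) ^ (q ^ d) = u ^ (M * i)" for i
  proof -
    have "M * i * q ^ d = M * i + (q ^ s - 1) * i"
      unfolding M using qd by (cases "q ^ d") (auto simp: algebra_simps)
    then show ?thesis
      unfolding power_mult[symmetric] u_power_eq_iff by (simp add: cong_def)
  qed
  then have sub: "insert 0 ((\<lambda>i. u ^ (M * i)) ` {..<q ^ d - 1}) \<subseteq> ?L"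
    using mem(3,9) u_mem q_gt_1 d(2) by auto
  have "inj_on (\<lambda>i. u ^ (M * i)) {..<q ^ d - 1}"
  proof (rule inj_onI)
    fix i j assume ij: "i \<in> {..<q ^ d - 1}" "j \<in> {..<q ^ d - 1}" "u ^ (M * i) = u ^ (M * j)"
    then have "M * i < q ^ s - 1" "M * j < q ^ s - 1"
      unfolding M using M_pos by (simp_all add: mult.commute)
    then have "M * i = M * j"
      using ij(3) u_inj by (auto dest: inj_onD)
    then show "i = j"
      using M_pos by simp
  qed
  then have "card (insert 0 ((\<lambda>i. u ^ (M * i)) ` {..<q ^ d - 1})) = q ^ d"
    using u_mem qd by (subst card_insert_disjoint) (auto simp: card_image)
  then have "q ^ d \<le> card ?L"
    using card_mono[OF _ sub] mem(1) by simp
  moreover have "card ?L \<le> q ^ d"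
    using card_mono[of "{x. x ^ (q ^ d) = x}" ?L] card_frobenius_fixed_le[OF qd, where 'a = 'a]
    by fastforce
  ultimately have "card ?L = q ^ d"
    by simp
  then show ?thesis
    using mem q_gt_1 d(2) unfolding finite_field_of_order_def
    by (auto simp: fadd power_mult_distrib power_inverse)
qed

text \<open>
  If \<open>f\<close> is a linearized polynomial $\sum_j c_j y^{q^j}$ with \<open>j < s\<close>, this is the coefficient
  $c_i$. The formula, a discrete Fourier coefficient on the cyclic multiplicative group, is
  meaningful for every map \<open>f\<close>, so that the multipliers studied below need not be
  written as polynomials beforehand.
\<close>

definition frobenius_coeff :: "nat \<Rightarrow> ('a \<Rightarrow> 'a) \<Rightarrow> 'a" where
  "frobenius_coeff i f = - (\<Sum>y\<in>K - {0}. f y / y ^ (q ^ i))"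

text \<open>
  For incongruent exponents the substitution of \<open>u * y\<close> for \<open>y\<close> multiplies the sum by
  $u^{q^j - q^i} \neq 1$, which forces it to be 0; otherwise $q^s - 1$ ones are added, and these
  give $-1$.
\<close>

lemma frobenius_coeff_power:
  "frobenius_coeff i (\<lambda>y. y ^ (q ^ j)) = (if [i = j] (mod s) then 1 else 0)"
proof (cases "[i = j] (mod s)")
  case True
  have same: "y ^ (q ^ i) = y ^ (q ^ j)" if "y \<in> K" for y
    using frobenius_mod[OF that, of i] frobenius_mod[OF that, of j] True by (simp add: cong_def)
  have "(\<Sum>y\<in>K - {0}. y ^ (q ^ j) / y ^ (q ^ i)) = (\<Sum>y\<in>K - {0}. 1)"
    by (rule sum.cong) (auto simp: same)
  also have "\<dots> = of_nat (q ^ s - 1)"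
    using mem(1,2,3) by (simp add: card_Diff_singleton)
  also have "\<dots> = -1"
  proof -
    obtain p e where pe: "prime p" "q = p ^ e" "e > 0"
      using q by (auto simp: primepow_def)
    have "CHAR('a) = p"
      using finite_field_CHAR[of K p "e * s"] ff pe by (simp add: power_mult)
    then have "of_nat (q ^ s) = (0 :: 'a)"
      using pe s_pos by (simp add: of_nat_eq_0_iff_char_dvd flip: power_mult)
    then show ?thesis
      using finite_field_order_gt_1[OF ff] by (subst of_nat_diff) auto
  qed
  finally show ?thesis
    using True by (simp add: frobenius_coeff_def)
next
  case False
  define t where "t = (\<Sum>y\<in>K - {0}. y ^ (q ^ j) / y ^ (q ^ i))"
  define c where "c = u ^ (q ^ j) / u ^ (q ^ i)"
  have u: "u \<in> K" "u \<noteq> 0"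
    using u_mem by auto
  have div: "y / u \<in> K" if "y \<in> K" for y
    using that u mem(7,8) by (simp add: divide_inverse)
  have "t = (\<Sum>y\<in>K - {0}. (u * y) ^ (q ^ j) / (u * y) ^ (q ^ i))"
    unfolding t_def
    by (rule sum.reindex_bij_witness[of _ "\<lambda>y. u * y" "\<lambda>y. y / u"]) (use u mem(7) div in auto)
  also have "\<dots> = c * t"
    by (simp add: t_def c_def sum_distrib_left power_mult_distrib)
  finally have "(1 - c) * t = 0"
    by (simp add: algebra_simps)
  moreover have "c \<noteq> 1"
    using False u by (auto simp: c_def u_frobenius_eq_iff cong_sym_eq)
  ultimately show ?thesis
    using False by (simp add: frobenius_coeff_def t_def)
qed

lemma frobenius_coeff_linear:
  "frobenius_coeff i (\<lambda>y. f y + g y) = frobenius_coeff i f + frobenius_coeff i g"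
  "frobenius_coeff i (\<lambda>y. f y - g y) = frobenius_coeff i f - frobenius_coeff i g"
  "frobenius_coeff i (\<lambda>y. c * f y) = c * frobenius_coeff i f"
  "frobenius_coeff i (\<lambda>y. f y * c) = frobenius_coeff i f * c"
  by (simp_all add: frobenius_coeff_def sum.distrib sum_subtractf sum_distrib_left
      sum_distrib_right add_divide_distrib diff_divide_distrib)

lemma frobenius_coeff_cong:
  "(\<And>y. y \<in> K \<Longrightarrow> f y = g y) \<Longrightarrow> frobenius_coeff i f = frobenius_coeff i g"
  by (simp add: frobenius_coeff_def)


lemma frobenius_coeff_ident: "frobenius_coeff i (\<lambda>y. y) = (if [i = 0] (mod s) then 1 else 0)"
  using frobenius_coeff_power[of i 0] by simp

end


section \<open>Middle multipliers\<close>

text \<open>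
  In a semifield these maps are the multiplications by elements of the middle nucleus. Unlike the
  nucleus, the notion makes sense without an identity element.
\<close>

definition middle_multiplier :: "'a presemifield \<Rightarrow> ('a \<Rightarrow> 'a) \<Rightarrow> bool" where
  "middle_multiplier P A \<longleftrightarrow> (case P of (S, mul) \<Rightarrow>
     (\<forall>x\<in>S. A x \<in> S) \<and>
     (\<exists>B. (\<forall>y\<in>S. B y \<in> S) \<and> (\<forall>x\<in>S. \<forall>y\<in>S. mul (A x) y = mul x (B y))))"

lemma middle_multiplierE:
  assumes "middle_multiplier (S, mul) A"
  obtains B where "\<And>x. x \<in> S \<Longrightarrow> A x \<in> S" "\<And>y. y \<in> S \<Longrightarrow> B y \<in> S"
    and "\<And>x y. x \<in> S \<Longrightarrow> y \<in> S \<Longrightarrow> mul (A x) y = mul x (B y)"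
  using assms unfolding middle_multiplier_def prod.case by (elim conjE exE) (rule that; blast)

lemma isotopic_card: "isotopic (S, mul) (S', mul') \<Longrightarrow> card S = card S'"
  by (auto simp: isotopic_def intro: bij_betw_same_card)

text \<open>
  If $(g_1, g_2, g_3)$ is the isotopism and $(T, U)$ a pair of maps on the target, then the pair
  $(g_1^{-1} T g_1, g_2^{-1} U g_2)$ does the same on the source.
\<close>

lemma isotopic_middle_multiplier:
  assumes iso: "isotopic (S, mul) (S', mul')"
    and closed: "\<And>x y. x \<in> S \<Longrightarrow> y \<in> S \<Longrightarrow> mul x y \<in> S"
  obtains g where "bij_betw g S S'"
    and "\<And>T. middle_multiplier (S', mul') T \<Longrightarrow>
           middle_multiplier (S, mul) (\<lambda>x. inv_into S g (T (g x)))"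
proof -
  obtain g1 g2 g3 where bij: "bij_betw g1 S S'" "bij_betw g2 S S'" "bij_betw g3 S S'"
    and g: "\<And>x y. x \<in> S \<Longrightarrow> y \<in> S \<Longrightarrow> mul' (g1 x) (g2 y) = g3 (mul x y)"
    using iso unfolding isotopic_def by auto
  have inv: "inv_into S h z \<in> S" "h (inv_into S h z) = z" if "bij_betw h S S'" "z \<in> S'" for h z
    using that by (auto simp: bij_betw_def inv_into_into f_inv_into_f)
  have g_mem: "h x \<in> S'" if "bij_betw h S S'" "x \<in> S" for h x
    using that by (auto simp: bij_betw_def)
  show ?thesis
  proof (rule that[OF bij(1)])
    fix T assume "middle_multiplier (S', mul') T"
    then obtain U where T: "\<And>x. x \<in> S' \<Longrightarrow> T x \<in> S'" and U: "\<And>x. x \<in> S' \<Longrightarrow> U x \<in> S'"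
      and TU: "\<And>x y. x \<in> S' \<Longrightarrow> y \<in> S' \<Longrightarrow> mul' (T x) y = mul' x (U y)"
      by (rule middle_multiplierE) blast
    define A B where "A = (\<lambda>x. inv_into S g1 (T (g1 x)))" and "B = (\<lambda>y. inv_into S g2 (U (g2 y)))"
    have A: "A x \<in> S" "g1 (A x) = T (g1 x)" if "x \<in> S" for x
      using inv[OF bij(1) T[OF g_mem[OF bij(1) that]]] by (auto simp: A_def)
    have B: "B y \<in> S" "g2 (B y) = U (g2 y)" if "y \<in> S" for y
      using inv[OF bij(2) U[OF g_mem[OF bij(2) that]]] by (auto simp: B_def)
    have "mul (A x) y = mul x (B y)" if xy: "x \<in> S" "y \<in> S" for x y
    proof -
      have "g3 (mul (A x) y) = mul' (T (g1 x)) (g2 y)"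
        using g[OF A(1)[OF xy(1)] xy(2)] A(2)[OF xy(1)] by simp
      also have "\<dots> = mul' (g1 x) (U (g2 y))"
        by (rule TU) (use g_mem bij xy in auto)
      also have "\<dots> = g3 (mul x (B y))"
        using g[OF xy(1) B(1)[OF xy(2)]] B(2)[OF xy(2)] by simp
      finally show ?thesis
        using bij(3) closed[OF A(1) xy(2)] closed[OF xy(1) B(1)] xy
        by (auto simp: bij_betw_def dest: inj_onD)
    qed
    then show "middle_multiplier (S, mul) (\<lambda>x. inv_into S g1 (T (g1 x)))"
      unfolding middle_multiplier_def A_def[symmetric] prod.case using A(1) B(1) by blast
  qed
qed

section \<open>The middle nucleus of a Bierbrauer presemifield\<close>

locale bierbrauer_field = primitive_field K u q "4 * m"
  for K :: "'a::field set" and u :: 'a and q m :: nat +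
  fixes n :: nat and v :: 'a
  assumes v: "v \<in> K" "v \<noteq> 0"
    and m: "odd m" "m > 1"
    and n: "even n" "coprime m n"
begin

definition bmul :: "'a \<Rightarrow> 'a \<Rightarrow> 'a" where
  "bmul x y = y ^ (q ^ n) * x + y * x ^ (q ^ n)
     - v * (y ^ (q ^ (m + n)) * x ^ (q ^ (3 * m)) + y ^ (q ^ (3 * m)) * x ^ (q ^ (m + n)))"

lemma bmul_mem: "x \<in> K \<Longrightarrow> y \<in> K \<Longrightarrow> bmul x y \<in> K"
  unfolding bmul_def using v mem(5-7,9) by simp

lemma bmul_commute: "bmul x y = bmul y x"
  by (simp add: bmul_def algebra_simps)

text \<open>
  The residues $0$, $n$, $m + n$, $3 m$ occurring in the product are distinct, and shifting the
  last three by $n$ leads out of this set and keeps them distinct. Each statement follows from parity, from reduction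
  modulo $m$, or, for $3 m + n$ and $m + n$, from $2 m \not\equiv 0$ modulo $4 m$.
\<close>

lemma exponents_incongruent:
  shows "\<not> [n = 0] (mod 4 * m)" "\<not> [n = m + n] (mod 4 * m)" "\<not> [n = 3 * m] (mod 4 * m)"
    "\<not> [m + n = 0] (mod 4 * m)" "\<not> [3 * m = 0] (mod 4 * m)" "\<not> [m + n = 3 * m] (mod 4 * m)"
    "\<not> [n + n = 0] (mod 4 * m)" "\<not> [n + n = n] (mod 4 * m)"
    "\<not> [n + n = m + n] (mod 4 * m)" "\<not> [n + n = 3 * m] (mod 4 * m)"
    "\<not> [n + n = m + n + n] (mod 4 * m)" "\<not> [n + n = 3 * m + n] (mod 4 * m)"
    "\<not> [m + n + n = 0] (mod 4 * m)" "\<not> [m + n + n = n] (mod 4 * m)"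
    "\<not> [m + n + n = m + n] (mod 4 * m)" "\<not> [m + n + n = 3 * m] (mod 4 * m)"
    "\<not> [m + n + n = 3 * m + n] (mod 4 * m)"
    "\<not> [3 * m + n = 0] (mod 4 * m)" "\<not> [3 * m + n = n] (mod 4 * m)"
    "\<not> [3 * m + n = m + n] (mod 4 * m)" "\<not> [3 * m + n = 3 * m] (mod 4 * m)"
proof -
  have parity: "\<not> [a = b] (mod 4 * m)" if "even a \<noteq> even b" for a b
  proof
    assume "[a = b] (mod 4 * m)"
    then have "[a = b] (mod 2)"
      by (rule cong_dvd_modulus_nat) simp
    then show False
      using that by (simp add: cong_def even_iff_mod_2_eq_zero)
  qed
  have modulo_m: "\<not> [a = b] (mod 4 * m)" if "\<not> [a = b] (mod m)" for a b
    using that cong_dvd_modulus_nat[of a b "4 * m" m] by auto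
  have n0: "\<not> m dvd n"
    using m n by (metis coprime_absorb_left nat_neq_iff nat_dvd_1_iff_1)
  then have n1: "\<not> m dvd n + n"
    using m by (metis coprime_dvd_mult_right_iff coprime_right_2_iff_odd mult_2)
  have n2: "\<not> [n + n = n] (mod m)"
    using n0 by (simp add: cong_add_lcancel_0_nat cong_0_iff)
  have mm: "\<not> [3 * m + n = m + n] (mod 4 * m)"
    using m by (subst cong_add_rcancel_nat) (simp add: cong_def)
  have mods: "n mod m \<noteq> 0" "(n + n) mod m \<noteq> 0" "(n + n) mod m \<noteq> n mod m"
    using n0 n1 n2 by (auto simp: cong_def mod_eq_0_iff_dvd)
  show "\<not> [n = 0] (mod 4 * m)" "\<not> [n + n = 0] (mod 4 * m)" "\<not> [n + n = n] (mod 4 * m)"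
    "\<not> [m + n = 3 * m] (mod 4 * m)" "\<not> [m + n + n = 3 * m] (mod 4 * m)"
    "\<not> [m + n + n = m + n] (mod 4 * m)" "\<not> [m + n + n = 3 * m + n] (mod 4 * m)"
    "\<not> [3 * m + n = 3 * m] (mod 4 * m)"
    by (rule modulo_m, use mods mods(3)[symmetric] in \<open>simp add: cong_def add.assoc\<close>)+
  show "\<not> [3 * m + n = m + n] (mod 4 * m)"
    by (rule mm)
  show "\<not> [n = m + n] (mod 4 * m)" "\<not> [n = 3 * m] (mod 4 * m)"
    "\<not> [m + n = 0] (mod 4 * m)" "\<not> [3 * m = 0] (mod 4 * m)"
    "\<not> [n + n = m + n] (mod 4 * m)" "\<not> [n + n = 3 * m] (mod 4 * m)"
    "\<not> [n + n = m + n + n] (mod 4 * m)" "\<not> [n + n = 3 * m + n] (mod 4 * m)"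
    "\<not> [m + n + n = 0] (mod 4 * m)" "\<not> [m + n + n = n] (mod 4 * m)"
    "\<not> [3 * m + n = 0] (mod 4 * m)" "\<not> [3 * m + n = n] (mod 4 * m)"
    by (rule parity, use m n in simp)+
qed

text \<open>
  The coefficients of $y^{q^n}$ and of $y$ in \<open>bmul (A x) y\<close> are $A(x)$ and $A(x)^{q^n}$, and
  those of \<open>bmul x (B y)\<close> lie in the span of the four Frobenius powers of $x$. Raising the first
  expansion to the power $q^n$ shifts its exponents by $n$; comparison with the second one kills
  all terms but one.
\<close>

lemma multiplier_is_scalar:
  assumes A: "\<And>x. x \<in> K \<Longrightarrow> A x \<in> K"
    and AB: "\<And>x y. x \<in> K \<Longrightarrow> y \<in> K \<Longrightarrow> bmul (A x) y = bmul x (B y)"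
  obtains a where "a \<in> K" "\<And>x. x \<in> K \<Longrightarrow> A x = a * x"
proof -
  note coeff_simps = bmul_def frobenius_coeff_linear frobenius_coeff_power frobenius_coeff_ident
  have coeff: "frobenius_coeff i (\<lambda>y. bmul (A x) y) = frobenius_coeff i (\<lambda>y. bmul x (B y))"
    if "x \<in> K" for i x
    by (rule frobenius_coeff_cong) (use that AB in auto)
  \<comment> \<open>Seen from the other side, every coefficient in \<open>y\<close> is a combination of Frobenius powers of
    \<open>x\<close>; the map \<open>B\<close> enters only through the constants.\<close>
  have span: "\<exists>c0 c1 c2 c3. \<forall>x\<in>K. frobenius_coeff i (\<lambda>y. bmul (A x) y) =
      c0 * x + c1 * x ^ (q ^ n) + c2 * x ^ (q ^ (m + n)) + c3 * x ^ (q ^ (3 * m))" for i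
  proof (intro exI ballI)
    fix x assume "x \<in> K"
    then have "frobenius_coeff i (\<lambda>y. bmul (A x) y) = frobenius_coeff i (\<lambda>y. bmul x (B y))"
      by (rule coeff)
    also have "\<dots> = frobenius_coeff i (\<lambda>y. B y ^ (q ^ n)) * x
        + frobenius_coeff i B * x ^ (q ^ n)
        + (- v * frobenius_coeff i (\<lambda>y. B y ^ (q ^ (3 * m)))) * x ^ (q ^ (m + n))
        + (- v * frobenius_coeff i (\<lambda>y. B y ^ (q ^ (m + n)))) * x ^ (q ^ (3 * m))"
      unfolding bmul_def frobenius_coeff_linear by (simp add: algebra_simps)
    finally show "frobenius_coeff i (\<lambda>y. bmul (A x) y) = \<dots>" .
  qed
  have "frobenius_coeff n (\<lambda>y. bmul (A x) y) = A x" for x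
    using exponents_incongruent by (simp add: coeff_simps cong_sym_eq)
  with span[of n] obtain c0 c1 c2 c3 where c: "\<And>x. x \<in> K \<Longrightarrow> A x =
      c0 * x + c1 * x ^ (q ^ n) + c2 * x ^ (q ^ (m + n)) + c3 * x ^ (q ^ (3 * m))"
    by metis
  have "frobenius_coeff 0 (\<lambda>y. bmul (A x) y) = A x ^ (q ^ n)" for x
    using exponents_incongruent by (simp add: coeff_simps cong_sym_eq)
  with span[of 0] obtain d0 d1 d2 d3 where d: "\<And>x. x \<in> K \<Longrightarrow> A x ^ (q ^ n) =
      d0 * x + d1 * x ^ (q ^ n) + d2 * x ^ (q ^ (m + n)) + d3 * x ^ (q ^ (3 * m))"
    by metis
  have power_power: "(x ^ (q ^ i)) ^ (q ^ j) = x ^ (q ^ (i + j))" for x :: 'a and i j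
    by (simp add: power_mult power_add)
  have *: "c0 ^ (q ^ n) * x ^ (q ^ n) + c1 ^ (q ^ n) * x ^ (q ^ (n + n))
        + c2 ^ (q ^ n) * x ^ (q ^ (m + n + n)) + c3 ^ (q ^ n) * x ^ (q ^ (3 * m + n)) =
      d0 * x + d1 * x ^ (q ^ n) + d2 * x ^ (q ^ (m + n)) + d3 * x ^ (q ^ (3 * m))"
    if "x \<in> K" for x
    using d[OF that] c[OF that] by (simp add: fadd power_mult_distrib power_power)
  have **: "frobenius_coeff i (\<lambda>x. c0 ^ (q ^ n) * x ^ (q ^ n) + c1 ^ (q ^ n) * x ^ (q ^ (n + n))
        + c2 ^ (q ^ n) * x ^ (q ^ (m + n + n)) + c3 ^ (q ^ n) * x ^ (q ^ (3 * m + n))) =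
      frobenius_coeff i (\<lambda>x. d0 * x + d1 * x ^ (q ^ n) + d2 * x ^ (q ^ (m + n)) + d3 * x ^ (q ^ (3 * m)))"
    for i
    by (rule frobenius_coeff_cong) (rule *)
  have "c1 ^ (q ^ n) = 0"
    using **[of "n + n"] exponents_incongruent by (simp add: coeff_simps cong_sym_eq)
  moreover have "c2 ^ (q ^ n) = 0"
    using **[of "m + n + n"] exponents_incongruent by (simp add: coeff_simps cong_sym_eq)
  moreover have "c3 ^ (q ^ n) = 0"
    using **[of "3 * m + n"] exponents_incongruent by (simp add: coeff_simps cong_sym_eq)
  ultimately have A_eq: "A x = c0 * x" if "x \<in> K" for x
    using c[OF that] by simp
  show ?thesis
    by (rule that[of c0]) (use A_eq[of 1] A[of 1] mem(4) A_eq in auto)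
qed

text \<open>
  The two scalars satisfy $a = b^{q^n}$, $a^{q^n} = b$ and $a^{q^{3m}} = b^{q^{m+n}}$. Hence $a$
  is fixed by the Frobenius powers with exponents $2 n$ and $2 m$, and $\gcd(2 n, 2 m) = 2$.
\<close>

theorem middle_multiplier_bierbrauer:
  assumes "middle_multiplier (K, bmul) A"
  obtains a where "a ^ (q ^ 2) = a" "\<And>x. x \<in> K \<Longrightarrow> A x = a * x"
proof -
  obtain B where A: "\<And>x. x \<in> K \<Longrightarrow> A x \<in> K" and B: "\<And>x. x \<in> K \<Longrightarrow> B x \<in> K"
    and AB: "\<And>x y. x \<in> K \<Longrightarrow> y \<in> K \<Longrightarrow> bmul (A x) y = bmul x (B y)"
    using assms by (rule middle_multiplierE) blast
  obtain a where a: "a \<in> K" "\<And>x. x \<in> K \<Longrightarrow> A x = a * x"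
    using multiplier_is_scalar[of A B] A AB by metis
  obtain b where b: "b \<in> K" "\<And>x. x \<in> K \<Longrightarrow> B x = b * x"
    using multiplier_is_scalar[of B A] B AB by (metis bmul_commute)
  have "bmul a y = bmul 1 (b * y)" if "y \<in> K" for y
    using AB[OF mem(4) that] a(2)[OF mem(4)] b(2)[OF that] by simp
  then have *: "frobenius_coeff i (\<lambda>y. bmul a y) = frobenius_coeff i (\<lambda>y. bmul 1 (b * y))" for i
    by (rule frobenius_coeff_cong)
  note coeff_simps = bmul_def frobenius_coeff_linear frobenius_coeff_power frobenius_coeff_ident
    power_mult_distrib
  have 1: "a = b ^ (q ^ n)"
    using *[of n] exponents_incongruent by (simp add: coeff_simps cong_sym_eq)
  have 2: "a ^ (q ^ n) = b"
    using *[of 0] exponents_incongruent by (simp add: coeff_simps cong_sym_eq)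
  have 3: "a ^ (q ^ (3 * m)) = b ^ (q ^ (m + n))"
    using *[of "m + n"] exponents_incongruent v by (simp add: coeff_simps cong_sym_eq)
  have power_power: "(x ^ (q ^ i)) ^ (q ^ j) = x ^ (q ^ (i + j))" for x :: 'a and i j
    by (simp add: power_mult power_add)
  have "a ^ (q ^ (2 * n)) = a"
    using 1 power_power[of a n n] unfolding 2 by (simp add: mult_2)
  moreover have "a ^ (q ^ (2 * m)) = a"
  proof -
    have "a ^ (q ^ (3 * m)) = a ^ (q ^ m)"
      using 3 power_power[of b n m] unfolding 1[symmetric] by (simp add: add.commute)
    then have "a ^ (q ^ (3 * m + m)) = a ^ (q ^ (m + m))"
      by (simp only: power_power[symmetric])
    then show ?thesis
      using finite_field_power_order[OF ff a(1)] by (simp add: mult_2)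
  qed
  ultimately have "a ^ (q ^ gcd (2 * n) (2 * m)) = a"
    by (rule frobenius_fixed_gcd)
  moreover have "gcd (2 * n) (2 * m) = 2"
    using n(2) by (metis coprime_iff_gcd_eq_1 gcd.commute gcd_mult_distrib_nat mult.right_neutral)
  ultimately have "a ^ (q ^ 2) = a"
    by (simp only:)
  then show ?thesis
    using a(2) by (rule that)
qed


subsection \<open>Consequences for isotopic presemifields\<close>

text \<open>
  A conjugate of \<open>T\<close> is the multiplication by a scalar $a$ with $a^{q^2} = a$. Iterates rather than
  scalars appear here because they can be compared across the isotopism.
\<close>

lemma iterated_multiplier:
  assumes iso: "isotopic (K, bmul) (S', mul')"
    and T: "middle_multiplier (S', mul') T" and X: "X \<in> S'"
  shows "(T ^^ (q ^ 2)) X = T X"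
proof -
  obtain g where g: "bij_betw g K S'"
    and *: "\<And>T. middle_multiplier (S', mul') T \<Longrightarrow>
              middle_multiplier (K, bmul) (\<lambda>x. inv_into K g (T (g x)))"
    by (rule isotopic_middle_multiplier[OF iso bmul_mem]) auto
  obtain a where a: "a ^ (q ^ 2) = a" "\<And>x. x \<in> K \<Longrightarrow> inv_into K g (T (g x)) = a * x"
    by (rule middle_multiplier_bierbrauer[OF *[OF T]]) blast
  have T_mem: "T Y \<in> S'" if "Y \<in> S'" for Y
    using T that by (auto simp: middle_multiplier_def)
  have step: "a * x \<in> K \<and> T (g x) = g (a * x)" if "x \<in> K" for x
  proof -
    have "T (g x) \<in> g ` K"
      using T_mem g that by (auto simp: bij_betw_def)
    then show ?thesis
      using a(2)[OF that] inv_into_into[of "T (g x)" g K] f_inv_into_f[of "T (g x)" g K] by simp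
  qed
  have iterate: "a ^ i * x \<in> K \<and> (T ^^ i) (g x) = g (a ^ i * x)" if "x \<in> K" for i x
    by (induction i) (use that step in \<open>auto simp: mult.assoc\<close>)
  obtain x where "x \<in> K" "X = g x"
    using X g by (auto simp: bij_betw_def)
  then show ?thesis
    using iterate[of x "q ^ 2"] step[of x] a(1) by simp
qed

text \<open>
  The elements of \<open>F\<close> act on \<open>S'\<close> by \<open>act\<close>, and the orbit of one point \<open>X\<close>, parametrized by
  \<open>h\<close>, already recovers the scalars.
\<close>

lemma scalar_field_degree:
  assumes iso: "isotopic (K, bmul) (S', mul')"
    and F: "finite_field_of_order F (p ^ f)" and p: "prime p" "q = p ^ e"
    and mult: "\<And>t. t \<in> F \<Longrightarrow> middle_multiplier (S', mul') (act t)"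
    and X: "X \<in> S'"
    and act: "\<And>t i. (act t ^^ i) X = h (t ^ i)" and inj: "inj h"
  shows "f dvd 2 * e"
proof (rule frobenius_fixes_subfield[OF F])
  show "p > 1"
    using p prime_gt_1_nat by blast
  fix t assume "t \<in> F"
  then have "(act t ^^ (q ^ 2)) X = (act t ^^ 1) X"
    using iterated_multiplier[OF iso mult X] by simp
  then have "t ^ (q ^ 2) = t"
    unfolding act using inj by (auto dest: injD)
  then show "t ^ (p ^ (2 * e)) = t"
    using p by (simp add: mult.commute flip: power_mult)
qed

text \<open>
  Comparing the orders gives $N = p^f$ with $f = 2 m e$, and this divides $2 e$ only for
  $m = 1$.
\<close>

lemma not_isotopic_pairs:
  fixes F :: "'b::field set"
  assumes F: "finite_field_of_order F N"
    and mult: "\<And>t. t \<in> F \<Longrightarrow> middle_multiplier (F \<times> F, mul') (\<lambda>(a, b). (t * a, t * b))"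
  shows "\<not> isotopic (K, bmul) (F \<times> F, mul')"
proof
  assume iso: "isotopic (K, bmul) (F \<times> F, mul')"
  obtain p e where pe: "prime p" "q = p ^ e" "e > 0"
    using q by (auto simp: primepow_def)
  note F' = finite_field_mem[OF F]
  have N: "N ^ 2 = p ^ (4 * m * e)"
    using isotopic_card[OF iso] F'(1,2) mem(2) pe
    by (simp add: card_cartesian_product power2_eq_square mult.commute flip: power_mult)
  obtain f where f: "N = p ^ f" "f * 2 = 4 * m * e"
    by (rule prime_power_root[OF pe(1) N]) auto
  have "f dvd 2 * e"
  proof (rule scalar_field_degree[OF iso _ pe(1,2) mult])
    show "((\<lambda>(a, b). (t * a, t * b)) ^^ i) (1, 0) = (t ^ i, 0)" for t :: 'b and i
      by (induction i) auto
  qed (use F F' f in \<open>auto simp: inj_def\<close>)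
  then have "m * (2 * e) dvd 1 * (2 * e)"
    using f(2) by (simp add: mult.left_commute mult.commute)
  then have "m dvd 1"
    using pe(3) by (simp only: dvd_times_right_cancel_iff)
  then show False
    using m by simp
qed

lemma not_isotopic_dickson:
  fixes D :: "('b::field \<times> 'b) presemifield"
  assumes D: "dickson_semifield D"
  shows "\<not> isotopic (K, bmul) D"
proof -
  obtain q' k L j \<sigma> where L: "finite_field_of_order L (q' ^ k)"
    and \<sigma>: "field_automorphism_on L \<sigma>"
    and D_eq: "D = (L \<times> L, \<lambda>(a, b) (c, d). (a * c + j * \<sigma> b * \<sigma> d, a * d + b * c))"
    using D unfolding dickson_semifield_def by blast
  show "\<not> isotopic (K, bmul) D"
    unfolding D_eq
  proof (rule not_isotopic_pairs[OF L])
    fix t assume "t \<in> L"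
    with \<sigma> show "middle_multiplier (L \<times> L, \<lambda>(a, b) (c, d). (a * c + j * \<sigma> b * \<sigma> d, a * d + b * c))
        (\<lambda>(a, b). (t * a, t * b))"
      unfolding middle_multiplier_def field_automorphism_on_def using finite_field_mem(7)[OF L]
      by (auto intro!: exI[of _ "\<lambda>(a, b). (t * a, t * b)"] simp: algebra_simps)
  qed
qed

lemma not_isotopic_cohen_ganley:
  fixes G :: "('b::field \<times> 'b) presemifield"
  assumes G: "cohen_ganley_semifield G"
  shows "\<not> isotopic (K, bmul) G"
proof -
  obtain s L j where L: "finite_field_of_order L (3 ^ s)"
    and G_eq: "G = (L \<times> L, \<lambda>(a, b) (c, d).
               (a * c + j * b * d + j ^ 3 * (b * d) ^ 9, a * d + b * c + j * (b * d) ^ 3))"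
    using G unfolding cohen_ganley_semifield_def by blast
  show "\<not> isotopic (K, bmul) G"
    unfolding G_eq
  proof (rule not_isotopic_pairs[OF L])
    fix t assume "t \<in> L"
    then show "middle_multiplier (L \<times> L, \<lambda>(a, b) (c, d).
               (a * c + j * b * d + j ^ 3 * (b * d) ^ 9, a * d + b * c + j * (b * d) ^ 3))
        (\<lambda>(a, b). (t * a, t * b))"
      unfolding middle_multiplier_def using finite_field_mem(7)[OF L]
      by (auto intro!: exI[of _ "\<lambda>(a, b). (t * a, t * b)"] simp: mult_ac)
  qed
qed

lemma not_isotopic_generalized_twisted_field:
  fixes T :: "'b::field presemifield"
  assumes "generalized_twisted_field T"
  shows "\<not> isotopic (K, bmul) T"
proof
  assume "isotopic (K, bmul) T"
  with assms obtain q' t k and L :: "'b set" where t: "odd t" "t > 1"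
    and L: "finite_field_of_order L (q' ^ t)"
    and F: "finite_field_of_order {x \<in> L. x ^ (q' ^ k) = x} q'"
    and iso: "isotopic (K, bmul) (L, \<lambda>x y. x ^ (q' ^ k) * y + x * y ^ (q' ^ k))"
    unfolding generalized_twisted_field_def by blast
  obtain p e where pe: "prime p" "q = p ^ e" "e > 0"
    using q by (auto simp: primepow_def)
  note L' = finite_field_mem[OF L]
  have order: "q' ^ t = p ^ (4 * m * e)"
    using isotopic_card[OF iso] L'(2) mem(2) pe by (simp add: mult.commute flip: power_mult)
  obtain f where f: "q' = p ^ f" "f * t = 4 * m * e"
    by (rule prime_power_root[OF pe(1) order]) (use t in auto)
  have "f dvd 2 * e"
  proof (rule scalar_field_degree[OF iso _ pe(1,2)])
    fix x assume "x \<in> {x \<in> L. x ^ (q' ^ k) = x}"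
    then show "middle_multiplier (L, \<lambda>x y. x ^ (q' ^ k) * y + x * y ^ (q' ^ k)) ((*) x)"
      unfolding middle_multiplier_def using L'(7)
      by (auto intro!: exI[of _ "(*) x"] simp: power_mult_distrib algebra_simps)
  next
    show "((*) x ^^ i) 1 = x ^ i" for x :: 'b and i
      by (induction i) auto
  qed (use F L' f in \<open>auto simp: inj_def\<close>)
  then obtain g where g: "2 * e = f * g"
    by blast
  have "f * t = 2 * m * (2 * e)"
    using f(2) by simp
  also have "\<dots> = f * (2 * m * g)"
    by (simp only: g mult.left_commute)
  finally have "t = 2 * m * g"
    by (rule mult_left_cancel[THEN iffD1, rotated]) (use f(2) m pe(3) in \<open>auto intro!: gr0I\<close>)
  then show False
    using t by simp
qed

lemma characteristic_3_order:
  assumes iso: "isotopic (K, bmul) (S', mul')" and card: "card S' = 3 ^ N"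
  obtains e where "N = 4 * m * e"
proof -
  have order: "q ^ (4 * m) = 3 ^ N"
    using isotopic_card[OF iso] card mem(2) by simp
  obtain f where "f * (4 * m) = N"
    by (rule prime_power_root[OF _ order]) (use m in auto)
  then show ?thesis
    by (intro that[of f]) (simp add: mult.commute)
qed

lemma not_isotopic_ganley:
  fixes G :: "('b::field \<times> 'b) presemifield"
  assumes G: "ganley_semifield G"
  shows "\<not> isotopic (K, bmul) G"
proof -
  obtain r L mul where r: "odd r" and L: "finite_field_of_order L (3 ^ r)" and G_eq: "G = (L \<times> L, mul)"
    using G unfolding ganley_semifield_def by blast
  show "\<not> isotopic (K, bmul) G"
  proof
    assume "isotopic (K, bmul) G"
    moreover have "card (L \<times> L) = 3 ^ (r + r)"
      using finite_field_mem(2)[OF L] by (simp add: card_cartesian_product power_add)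
    ultimately obtain e where "r + r = 4 * m * e"
      unfolding G_eq by (rule characteristic_3_order)
    then have "r = 2 * (m * e)"
      by simp
    then show False
      using r by simp
  qed
qed

lemma not_isotopic_coulter_matthews_ding_yuan:
  fixes P :: "'b::field presemifield"
  assumes P: "coulter_matthews_ding_yuan_presemifield P"
  shows "\<not> isotopic (K, bmul) P"
proof -
  obtain e L mul where e: "odd e" and L: "finite_field_of_order L (3 ^ e)" and P_eq: "P = (L, mul)"
    using P unfolding coulter_matthews_ding_yuan_presemifield_def by blast
  show "\<not> isotopic (K, bmul) P"
  proof
    assume "isotopic (K, bmul) P"
    then obtain f where "e = 4 * m * f"
      using finite_field_mem(2)[OF L] unfolding P_eq by (rule characteristic_3_order)
    then show False
      using e by simp
  qed
qed

lemma not_isotopic_penttila_williams: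
  fixes P :: "('b::field \<times> 'b) presemifield"
  assumes P: "penttila_williams_semifield P"
  shows "\<not> isotopic (K, bmul) P"
proof -
  obtain L mul where L: "finite_field_of_order L (3 ^ 5)" and P_eq: "P = (L \<times> L, mul)"
    using P unfolding penttila_williams_semifield_def by blast
  show "\<not> isotopic (K, bmul) P"
  proof
    assume "isotopic (K, bmul) P"
    moreover have "card (L \<times> L) = 3 ^ 10"
      using finite_field_mem(2)[OF L] by (simp add: card_cartesian_product)
    ultimately obtain e where "10 = 4 * m * e"
      unfolding P_eq by (rule characteristic_3_order)
    then have "4 dvd (10 :: nat)"
      by (metis dvd_triv_left mult.assoc)
    then show False
      by simp
  qed
qed

lemma not_isotopic_coulter_henderson_kosick:
  fixes P :: "'b::field presemifield"
  assumes P: "coulter_henderson_kosick_presemifield P"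
  shows "\<not> isotopic (K, bmul) P"
proof -
  obtain L mul where L: "finite_field_of_order L (3 ^ 8)" and P_eq: "P = (L, mul)"
    using P unfolding coulter_henderson_kosick_presemifield_def by blast
  show "\<not> isotopic (K, bmul) P"
  proof
    assume "isotopic (K, bmul) P"
    then obtain e where "8 = 4 * m * e"
      using finite_field_mem(2)[OF L] unfolding P_eq by (rule characteristic_3_order)
    then have "m dvd 2"
      by (intro dvdI[of _ _ e]) (simp add: mult.commute)
    then have "m \<le> 2"
      by (rule dvd_imp_le) simp
    then show False
      using m by (cases "m = 2") auto
  qed
qed

end

text \<open>
  As $m$ is odd, an odd $n$ would make $2 m / \gcd(2 m, n)$ even.
\<close>

lemma bierbrauer_presemifieldE:
  assumes "bierbrauer_presemifield q m B" and m: "odd m" "m > 1"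
  obtains K u n v where "bierbrauer_field K u q m n v" "B = (K, bierbrauer_field.bmul q m n v)"
proof -
  obtain K n u v where q: "odd_prime_power q"
    and K: "finite_field_of_order K (q ^ (4 * m))" "primitive_element K u"
    and v: "v = u ^ (q ^ m - 1)"
    and n: "gcd m n = 1" "odd (2 * m div gcd (2 * m) n)"
    and B: "B = (K, \<lambda>x y. y ^ (q ^ n) * x + y * x ^ (q ^ n)
                  - v * (y ^ (q ^ (m + n)) * x ^ (q ^ (3 * m))
                         + y ^ (q ^ (3 * m)) * x ^ (q ^ (m + n))))"
    using assms(1) unfolding bierbrauer_presemifield_def by (elim conjE exE) (rule that; assumption)
  interpret primitive_field K u q "4 * m"
    by unfold_locales (use K q in \<open>auto simp: odd_prime_power_def\<close>)
  have "even n"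
  proof (rule ccontr)
    assume odd: "odd n"
    have "2 * m = (2 * m div gcd (2 * m) n) * gcd (2 * m) n"
      by simp
    moreover have "odd (gcd (2 * m) n)"
      using odd by (meson dvd_trans gcd_dvd2)
    ultimately show False
      using n(2) by (metis dvd_triv_left even_mult_iff)
  qed
  moreover have "v \<in> K" "v \<noteq> 0"
    using v u_mem mem(9) by auto
  moreover have "coprime m n"
    using n(1) by (simp only: coprime_iff_gcd_eq_1)
  ultimately interpret bierbrauer_field K u q m n v
    by (unfold_locales) (use m in simp_all)
  show ?thesis
    by (rule that[OF bierbrauer_field_axioms]) (simp add: B bmul_def fun_eq_iff)
qed

section \<open>Bierbrauer presemifields of order $q^4$\<close>

lemma prime_field_linear_onI:
  fixes S :: "'a::comm_monoid_add set" and g :: "'a \<Rightarrow> 'b::ab_group_add"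
  assumes add: "\<And>x y. x \<in> S \<Longrightarrow> y \<in> S \<Longrightarrow> g (x + y) = g x + g y"
    and S: "0 \<in> S" "\<And>x y. x \<in> S \<Longrightarrow> y \<in> S \<Longrightarrow> x + y \<in> S"
  shows "prime_field_linear_on p S g"
proof -
  have "g 0 = g 0 + g 0"
    using add[OF S(1) S(1)] by simp
  then have zero: "g 0 = 0"
    by simp
  have "(\<Sum>i<c. x) \<in> S \<and> g (\<Sum>i<c. x) = (\<Sum>i<c. g x)" if "x \<in> S" for c :: nat and x
    by (induction c) (use that S zero add in auto)
  then show ?thesis
    unfolding prime_field_linear_on_def using add by blast
qed

text \<open>
  The maps of the isotopism are given by their inverses, since linear combinations of coordinates
  are easier to write down than the coordinates themselves.
\<close>

lemma isotopicI_inverse: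
  fixes S :: "'a::ab_group_add set" and S' :: "'b::ab_group_add set"
  assumes char: "additive_characteristic p S" "additive_characteristic p S'"
    and S: "0 \<in> S" "\<And>x y. x \<in> S \<Longrightarrow> y \<in> S \<Longrightarrow> x + y \<in> S"
    and S': "\<And>x y. x \<in> S' \<Longrightarrow> y \<in> S' \<Longrightarrow> x + y \<in> S'"
      "\<And>x y. x \<in> S' \<Longrightarrow> y \<in> S' \<Longrightarrow> mul' x y \<in> S'"
    and bij: "bij_betw h1 S' S" "bij_betw h2 S' S" "bij_betw h3 S' S"
    and add: "\<And>x y. h1 (x + y) = h1 x + h1 y" "\<And>x y. h2 (x + y) = h2 x + h2 y"
      "\<And>x y. h3 (x + y) = h3 x + h3 y"
    and mul: "\<And>x y. x \<in> S' \<Longrightarrow> y \<in> S' \<Longrightarrow> mul (h1 x) (h2 y) = h3 (mul' x y)"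
  shows "isotopic (S, mul) (S', mul')"
proof -
  have inv: "inv_into S' h y \<in> S'" "h (inv_into S' h y) = y"
    if "bij_betw h S' S" "y \<in> S" for h :: "'b \<Rightarrow> 'a" and y
    using that by (auto simp: bij_betw_def inv_into_into f_inv_into_f)
  have lin: "prime_field_linear_on p S (inv_into S' h)"
    if h: "bij_betw h S' S" and add: "\<And>x y. h (x + y) = h x + h y" for h :: "'b \<Rightarrow> 'a"
  proof (rule prime_field_linear_onI)
    fix x y assume xy: "x \<in> S" "y \<in> S"
    show "inv_into S' h (x + y) = inv_into S' h x + inv_into S' h y"
    proof (rule inv_into_f_eq)
      show "inj_on h S'"
        using h by (simp add: bij_betw_def)
    qed (use inv[OF h] xy S' add in auto)
  qed (use S in auto)
  have "mul' (inv_into S' h1 x) (inv_into S' h2 y) = inv_into S' h3 (mul x y)"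
    if xy: "x \<in> S" "y \<in> S" for x y
  proof (rule inv_into_f_eq[symmetric])
    show "inj_on h3 S'"
      using bij(3) by (simp add: bij_betw_def)
    show "mul' (inv_into S' h1 x) (inv_into S' h2 y) \<in> S'"
      using S'(2) inv(1)[OF bij(1) xy(1)] inv(1)[OF bij(2) xy(2)] by blast
    show "h3 (mul' (inv_into S' h1 x) (inv_into S' h2 y)) = mul x y"
      using mul[OF inv(1)[OF bij(1) xy(1)] inv(1)[OF bij(2) xy(2)]]
        inv(2)[OF bij(1) xy(1)] inv(2)[OF bij(2) xy(2)] by simp
  qed
  moreover have "\<forall>g\<in>{inv_into S' h1, inv_into S' h2, inv_into S' h3}.
      bij_betw g S S' \<and> prime_field_linear_on p S g"
    using bij add lin by (auto intro: bij_betw_inv_into)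
  ultimately show ?thesis
    unfolding isotopic_def prod.case using char by blast
qed

text \<open>
  All constants of the isotopism are powers of the primitive element, so that their relations
  become congruences of exponents modulo $q^4 - 1$. Put $q = 4 r + 1$. The odd number
  $c = (q + 1) (q^2 + 1) / 4$ is \<open>2 * \<nu> + 1\<close> below, $q^4 - 1 = 4 (q - 1) c = 16 r c$, and
  \<open>l\<close> is $(3 c + 1) / 2$. The element \<open>\<iota>\<close> is a fourth root of unity, \<open>\<rho>\<close> a square root of
  \<open>- \<iota>\<close>, and \<open>\<omega>\<close> is negated by $x \mapsto x^{q^2}$.
\<close>

locale bierbrauer_field_4 = primitive_field K u q 4
  for K :: "'a::field set" and u :: 'a and q :: nat +
  fixes r :: nat
  assumes q_eq: "q = 4 * r + 1"
begin

definition \<nu> :: nat where "\<nu> = 8 * r ^ 3 + 8 * r ^ 2 + 3 * r"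
definition l :: nat where "l = 3 * \<nu> + 2"
definition \<iota> :: 'a where "\<iota> = u ^ (4 * r * (2 * \<nu> + 1))"
definition \<rho> :: 'a where "\<rho> = u ^ (6 * r * (2 * \<nu> + 1))"
definition \<omega> :: 'a where "\<omega> = u ^ (8 * r ^ 2 + 4 * r + 1)"
definition \<mu> :: 'a where "\<mu> = u ^ ((q + 1) * l)"
definition \<kappa> :: 'a where "\<kappa> = u ^ ((q ^ 2 + 1) * q * l)"
definition L :: "'a set" where "L = {x \<in> K. x ^ (q ^ 2) = x}"

lemma r_pos: "r > 0"
  using q_eq q_gt_1 by simp

lemma q4_eq: "q ^ 4 = 16 * r * (2 * \<nu> + 1) + 1"
  by (simp add: q_eq \<nu>_def power4_eq_xxxx power3_eq_cube power2_eq_square algebra_simps)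

lemma q4_minus_1: "q ^ 4 - 1 = 16 * r * (2 * \<nu> + 1)"
  using q4_eq by simp

lemma u_period: "u ^ (i + 16 * r * (2 * \<nu> + 1) * j) = u ^ i"
  unfolding u_power_eq_iff q4_minus_1 by (simp add: cong_def)

lemma u_half_not_1: "u ^ (8 * r * (2 * \<nu> + 1)) \<noteq> 1"
proof -
  have "u ^ (8 * r * (2 * \<nu> + 1)) \<noteq> u ^ 0"
    unfolding u_power_eq_iff q4_minus_1 using r_pos by (simp add: cong_def)
  then show ?thesis
    by simp
qed

lemma u_half: "u ^ (8 * r * (2 * \<nu> + 1)) = -1"
proof -
  have "8 * r * (2 * \<nu> + 1) * 2 = 0 + 16 * r * (2 * \<nu> + 1) * 1"
    by simp
  then have "(u ^ (8 * r * (2 * \<nu> + 1))) ^ 2 = u ^ 0"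
    by (simp only: power_mult[symmetric] u_period)
  then show ?thesis
    using u_half_not_1 by (simp only: power_0 power2_eq_1_iff) blast
qed

lemma two_nonzero: "(2 :: 'a) \<noteq> 0"
proof
  assume "(2 :: 'a) = 0"
  then have "1 + 1 = (0 :: 'a)"
    by (simp only: one_add_one)
  then have "- 1 = (1 :: 'a)"
    by (rule minus_unique)
  then show False
    using u_half u_half_not_1 by simp
qed

lemma mem_nonzero: "u ^ i \<in> K" "u ^ i \<noteq> 0"
  using u_mem mem(9) by auto

lemma \<iota>_square: "\<iota> ^ 2 = -1"
proof -
  have "4 * r * (2 * \<nu> + 1) * 2 = 8 * r * (2 * \<nu> + 1)"
    by simp
  then show ?thesis
    unfolding \<iota>_def by (simp only: power_mult[symmetric] u_half)
qed

lemma \<iota>_fixed: "\<iota> ^ q = \<iota>"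
proof -
  have "q = 2 * (2 * r) + 1"
    by (simp add: q_eq)
  then have "\<iota> ^ q = (\<iota> ^ 2) ^ (2 * r) * \<iota>"
    by (simp only: power_add power_mult power_one_right)
  then show ?thesis
    by (simp add: \<iota>_square)
qed

lemma \<omega>_conj: "\<omega> ^ (q ^ 2) = - \<omega>"
proof -
  have "(8 * r ^ 2 + 4 * r + 1) * q ^ 2 = 8 * r * (2 * \<nu> + 1) + (8 * r ^ 2 + 4 * r + 1)"
    by (simp add: q_eq \<nu>_def power3_eq_cube power2_eq_square algebra_simps)
  then have "\<omega> ^ (q ^ 2) = u ^ (8 * r * (2 * \<nu> + 1)) * \<omega>"
    unfolding \<omega>_def by (simp only: power_mult[symmetric] power_add[symmetric])
  then show ?thesis
    by (simp only: u_half mult_minus1)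
qed

lemma \<rho>_square: "\<rho> ^ 2 = - \<iota>"
proof -
  have "6 * r * (2 * \<nu> + 1) * 2 = 8 * r * (2 * \<nu> + 1) + 4 * r * (2 * \<nu> + 1)"
    by simp
  then have "\<rho> ^ 2 = u ^ (8 * r * (2 * \<nu> + 1)) * \<iota>"
    unfolding \<rho>_def \<iota>_def by (simp only: power_mult[symmetric] power_add[symmetric])
  then show ?thesis
    by (simp only: u_half mult_minus1)
qed

lemma \<rho>_fixed: "\<rho> ^ (q ^ 2) = \<rho>"
proof -
  have "6 * r * (2 * \<nu> + 1) * q ^ 2
      = 6 * r * (2 * \<nu> + 1) + 16 * r * (2 * \<nu> + 1) * (3 * r * (2 * r + 1))"
    by (simp add: q_eq power2_eq_square algebra_simps)
  then show ?thesis
    unfolding \<rho>_def power_mult[symmetric] by (simp only: u_period)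
qed

lemma \<kappa>_fixed: "\<kappa> ^ (q ^ 2) = \<kappa>"
proof -
  have "(q ^ 2 + 1) * q * l * q ^ 2 = (q ^ 2 + 1) * q * l + 16 * r * (2 * \<nu> + 1) * (q * l)"
  proof -
    have "(q ^ 2 + 1) * q * l * q ^ 2 = q ^ 4 * (q * l) + q ^ 2 * q * l"
      by (simp add: algebra_simps eval_nat_numeral)
    then show ?thesis
      unfolding q4_eq by (simp add: algebra_simps eval_nat_numeral)
  qed
  then show ?thesis
    unfolding \<kappa>_def power_mult[symmetric] by (simp only: u_period)
qed

text \<open>
  Multiplying the arguments of the product by \<open>\<mu>\<close> and \<open>\<kappa> * \<mu>\<close> multiplies $v$, relative to the
  trace form, by $\kappa^{q-1} \mu^{2 q^3 - q^2 - 1}$. The exponent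
  $2 q^3 - q^2 - 1 = (q - 1) (2 q^2 + q + 1)$ and the exponent $(q - 1) (q^2 + 1)$ available
  through $\kappa$ suffice to
  reach \<open>\<iota>\<close>, because $q^2 + 1$ and $2 q^2 + q + 1$ have greatest common divisor 2 and
  $c - 1$ is even. The exponents of \<open>\<mu>\<close> and \<open>\<kappa>\<close> come from solving
  the resulting linear congruence.
\<close>

lemma scaling_identity: "u ^ (q - 1) * \<kappa> ^ q * (\<mu> ^ (q ^ 3)) ^ 2 = \<iota> * \<kappa> * \<mu> ^ (q ^ 2) * \<mu>"
proof -
  have "(q - 1) + (q ^ 2 + 1) * q * l * q + (q + 1) * l * q ^ 3 * 2
      = 4 * r * (2 * \<nu> + 1) + (q ^ 2 + 1) * q * l + (q + 1) * l * q ^ 2 + (q + 1) * l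
        + 16 * r * (2 * \<nu> + 1) * (9 * \<nu> + 5)"
  proof -
    \<comment> \<open>The terms in \<open>z\<close> occur on both sides. What is left contains \<open>q\<close> only linearly and through
      $q^4$, for which its value is substituted.\<close>
    define z where "z = 2 * q ^ 3 + q ^ 2"
    have "(q - 1) + (q ^ 2 + 1) * q * l * q + (q + 1) * l * q ^ 3 * 2 = (q - 1) + l * (3 * q ^ 4 + z)"
      by (simp add: z_def power4_eq_xxxx power3_eq_cube power2_eq_square algebra_simps)
    also have "\<dots> = 4 * r * (2 * \<nu> + 1) + l * (z + 2 * q + 1) + 16 * r * (2 * \<nu> + 1) * (9 * \<nu> + 5)"
      unfolding q4_eq by (simp add: q_eq l_def algebra_simps)
    also have "l * (z + 2 * q + 1) = (q ^ 2 + 1) * q * l + (q + 1) * l * q ^ 2 + (q + 1) * l"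
      by (simp add: z_def power3_eq_cube power2_eq_square algebra_simps)
    finally show ?thesis
      by (simp only: add.assoc)
  qed
  then show ?thesis
    unfolding \<kappa>_def \<mu>_def \<iota>_def power_mult[symmetric] power_add[symmetric]
    by (simp only: u_period)
qed

lemma nonzero: "\<iota> \<noteq> 0" "\<rho> \<noteq> 0" "\<omega> \<noteq> 0" "\<mu> \<noteq> 0" "\<kappa> \<noteq> 0"
  and in_K: "\<iota> \<in> K" "\<omega> \<in> K" "\<mu> \<in> K" "\<kappa> \<in> K"
  unfolding \<iota>_def \<rho>_def \<omega>_def \<mu>_def \<kappa>_def by (fact mem_nonzero)+

lemma L_field: "finite_field_of_order L (q ^ 2)"
  unfolding L_def by (rule fixed_field) simp_all

lemmas L_mem = finite_field_mem[OF L_field]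

lemma L_subset: "L \<subseteq> K"
  by (auto simp: L_def)

lemma L_power: "x \<in> L \<Longrightarrow> x ^ (q ^ 2) = x"
  by (simp add: L_def)

lemma power_q_q: "(x ^ q) ^ q = x ^ (q ^ 2)" for x :: 'a
  by (simp add: power2_eq_square power_mult)

lemma power_q_add: "(x + y) ^ q = x ^ q + y ^ q" "(x - y) ^ q = x ^ q - y ^ q" for x y :: 'a
  using fadd[of x y 1] by simp_all

lemma power_minus: "(- x) ^ q = - (x ^ q)" for x :: 'a
  by (rule power_minus_odd) (simp add: q_eq)

lemma \<iota>_in_L: "\<iota> \<in> L"
  using in_K(1) \<iota>_fixed by (simp add: L_def flip: power_q_q)

definition j :: 'a where "j = - \<iota> * (\<omega> ^ q) ^ 2"

lemma \<omega>q_conj: "(\<omega> ^ q) ^ (q ^ 2) = - (\<omega> ^ q)"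
proof -
  have "(\<omega> ^ q) ^ (q ^ 2) = (\<omega> ^ (q ^ 2)) ^ q"
    by (simp add: mult.commute flip: power_mult)
  then show ?thesis
    by (simp only: \<omega>_conj power_minus)
qed

lemma j_in_L: "j \<in> L"
proof -
  have "((\<omega> ^ q) ^ 2) ^ (q ^ 2) = ((\<omega> ^ q) ^ (q ^ 2)) ^ 2"
    by (simp only: power_mult[symmetric] mult_ac)
  also have "\<dots> = (\<omega> ^ q) ^ 2"
    by (simp only: \<omega>q_conj power2_minus)
  finally have "(\<omega> ^ q) ^ 2 \<in> L"
    using mem(9) in_K by (simp add: L_def)
  then have "0 - \<iota> * (\<omega> ^ q) ^ 2 \<in> L"
    using L_mem(3,6,7) \<iota>_in_L by blast
  then show ?thesis
    by (simp add: j_def)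
qed

lemma zero_power_q2: "(0 :: 'a) ^ (q ^ 2) = 0"
  by (simp add: q_eq)

lemma j_power_q: "j ^ q = - \<iota> * \<omega> ^ 2"
proof -
  have "j ^ q = - (\<iota> ^ q) * ((\<omega> ^ q) ^ q) ^ 2"
    unfolding j_def by (simp add: power_minus power_mult_distrib mult_ac flip: power_mult)
  then show ?thesis
    by (simp only: \<iota>_fixed power_q_q \<omega>_conj power2_minus)
qed

text \<open>
  The square roots of \<open>j\<close> are $\pm \rho \omega^q$, and both are negated by $x \mapsto x^{q^2}$.
\<close>

lemma j_nonsquare: "nonsquare_in L j"
proof -
  have "j \<noteq> z ^ 2" if z: "z \<in> L" for z
  proof
    assume "j = z ^ 2"
    then have "(\<rho> * \<omega> ^ q) ^ 2 = z ^ 2"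
      by (simp add: j_def power_mult_distrib \<rho>_square)
    then have "z = \<rho> * \<omega> ^ q \<or> z = - (\<rho> * \<omega> ^ q)"
      by (metis minus_minus power2_eq_iff)
    moreover have "(\<rho> * \<omega> ^ q) ^ (q ^ 2) = - (\<rho> * \<omega> ^ q)"
      by (simp add: power_mult_distrib \<rho>_fixed \<omega>q_conj)
    moreover have "(- (\<rho> * \<omega> ^ q)) ^ (q ^ 2) = - ((\<rho> * \<omega> ^ q) ^ (q ^ 2))"
      by (rule power_minus_odd) (simp add: q_eq)
    ultimately have "z = - z"
      using L_power[OF z] by (elim disjE) (simp_all only: minus_minus)
    then have "2 * z = 0"
      by (metis add.right_inverse mult_2)
    then show False
      using two_nonzero nonzero \<open>z = \<rho> * \<omega> ^ q \<or> z = - (\<rho> * \<omega> ^ q)\<close> by auto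
  qed
  then show ?thesis
    using j_in_L by (auto simp: nonsquare_in_def)
qed

definition dmul :: "'a \<times> 'a \<Rightarrow> 'a \<times> 'a \<Rightarrow> 'a \<times> 'a" where
  "dmul = (\<lambda>(a, b) (c, d). (a * c + j * b ^ q * d ^ q, a * d + b * c))"

lemma dickson_dmul:
  assumes "odd_prime_power q"
  shows "dickson_semifield (L \<times> L, dmul)"
proof -
  let ?F = "{x \<in> K. x ^ (q ^ 1) = x}"
  have F: "finite_field_of_order ?F q"
    using fixed_field[of 1] by simp
  have F_L: "?F \<subseteq> L"
    by (auto simp: L_def simp flip: power_q_q)
  have "bij_betw (\<lambda>x. x ^ q) L L"
    by (rule bij_betw_byWitness[of _ "\<lambda>x. x ^ q"]) (auto simp: power_q_q L_power intro: L_mem)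
  then have aut: "field_automorphism_on L (\<lambda>x. x ^ q)"
    unfolding field_automorphism_on_def by (simp add: power_q_add power_mult_distrib)
  have "\<exists>x\<in>L. x ^ q \<noteq> x"
  proof (rule ccontr)
    assume "\<not> (\<exists>x\<in>L. x ^ q \<noteq> x)"
    then have "L \<subseteq> ?F"
      using L_subset by auto
    then have "q ^ 2 \<le> q"
      using card_mono[of ?F L] finite_field_mem(1,2)[OF F] L_mem(2) by simp
    then show False
      using q_gt_1 by (simp add: power2_eq_square)
  qed
  with assms F F_L L_field aut j_nonsquare show ?thesis
    unfolding dickson_semifield_def dmul_def
    by (intro exI[of _ q] exI[of _ 2] exI[of _ L] exI[of _ ?F] exI[of _ j] exI[of _ "\<lambda>x. x ^ q"]) auto
qed

text \<open>
  The inverses of the three maps of the isotopism. The first two send a pair to a multiple of the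
  element with these coordinates over \<open>L\<close> in the basis $1, \omega$.
\<close>

definition h1 :: "'a \<times> 'a \<Rightarrow> 'a" where
  "h1 = (\<lambda>(a, b). \<mu> * (a + b * \<omega>))"
definition h2 :: "'a \<times> 'a \<Rightarrow> 'a" where
  "h2 = (\<lambda>(a, b). \<kappa> * \<mu> * (a + b * \<omega>))"
definition h3 :: "'a \<times> 'a \<Rightarrow> 'a" where
  "h3 = (\<lambda>(a, b). 2 * \<kappa> * \<mu> ^ (q ^ 2) * \<mu> * (a - \<iota> * a ^ q + \<iota> * \<omega> ^ q * b ^ q))"

lemma bij_from_pairs:
  assumes add: "\<And>x y. h (x + y) = h x + h y"
    and K: "\<And>a b. a \<in> L \<Longrightarrow> b \<in> L \<Longrightarrow> h (a, b) \<in> K"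
    and kernel: "\<And>a b. a \<in> L \<Longrightarrow> b \<in> L \<Longrightarrow> h (a, b) = 0 \<Longrightarrow> a = 0 \<and> b = 0"
  shows "bij_betw h (L \<times> L) K"
proof -
  have "inj_on h (L \<times> L)"
  proof (rule inj_onI, clarify)
    fix a b c d assume *: "a \<in> L" "b \<in> L" "c \<in> L" "d \<in> L" "h (a, b) = h (c, d)"
    have "h (a, b) = h (a - c, b - d) + h (c, d)"
      by (simp flip: add)
    then have "h (a - c, b - d) = 0"
      using *(5) by simp
    then show "a = c \<and> b = d"
      using kernel[of "a - c" "b - d"] L_mem(6) * by simp
  qed
  moreover have "h ` (L \<times> L) \<subseteq> K"
    using K by auto
  moreover have "card (L \<times> L) = card K"
    using L_mem(2) mem(2) by (simp add: card_cartesian_product flip: power_add)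
  ultimately show ?thesis
    using mem(1) by (metis bij_betw_def card_image card_subset_eq)
qed

lemma pair_conj:
  assumes "a \<in> L" "b \<in> L"
  shows "(a + b * \<omega>) ^ (q ^ 2) = a - b * \<omega>"
    and "(a + b * \<omega>) ^ (q ^ 3) = a ^ q - b ^ q * \<omega> ^ q"
proof -
  show *: "(a + b * \<omega>) ^ (q ^ 2) = a - b * \<omega>"
    using assms by (simp add: fadd power_mult_distrib L_power \<omega>_conj)
  have "(a + b * \<omega>) ^ (q ^ 3) = ((a + b * \<omega>) ^ (q ^ 2)) ^ q"
    by (simp add: power3_eq_cube power2_eq_square flip: power_mult)
  then show "(a + b * \<omega>) ^ (q ^ 3) = a ^ q - b ^ q * \<omega> ^ q"
    unfolding * by (simp add: power_q_add power_mult_distrib)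
qed

lemma bij_h1: "bij_betw h1 (L \<times> L) K" and bij_h2: "bij_betw h2 (L \<times> L) K"
proof -
  have kernel: "a = 0 \<and> b = 0" if ab: "a \<in> L" "b \<in> L" "a + b * \<omega> = 0" for a b
  proof -
    have "a - b * \<omega> = 0"
      using pair_conj(1)[OF ab(1,2)] by (simp add: ab(3) zero_power_q2)
    then have "2 * a = 0"
      using ab(3) by (simp add: algebra_simps)
    then have "a = 0"
      using two_nonzero by simp
    then show ?thesis
      using ab(3) nonzero by simp
  qed
  have K: "a + b * \<omega> \<in> K" if "a \<in> L" "b \<in> L" for a b
    using that L_subset in_K by (intro mem(5,7)) auto
  show "bij_betw h1 (L \<times> L) K"
  proof (rule bij_from_pairs)
    show "h1 (x + y) = h1 x + h1 y" for x y
      by (cases x; cases y) (simp add: h1_def algebra_simps)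
  qed (use in_K nonzero K kernel mem(7) in \<open>auto simp: h1_def\<close>)
  show "bij_betw h2 (L \<times> L) K"
  proof (rule bij_from_pairs)
    show "h2 (x + y) = h2 x + h2 y" for x y
      by (cases x; cases y) (simp add: h2_def algebra_simps)
  qed (use in_K nonzero K kernel mem(7) in \<open>auto simp: h2_def\<close>)
qed

text \<open>
  Up to the constant factor, the two summands of a value of \<open>h3\<close> are separated by
  $x \mapsto x^{q^2}$, which fixes $a - \iota a^q$ and negates the other one. If $a = \iota a^q$, then $a^q = \iota a$, so that
  $a = \iota^2 a = -a$.
\<close>

lemma bij_h3: "bij_betw h3 (L \<times> L) K"
proof (rule bij_from_pairs)
  show "h3 (x + y) = h3 x + h3 y" for x y
    by (cases x; cases y) (simp add: h3_def power_q_add algebra_simps)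
  show "h3 (a, b) \<in> K" if "a \<in> L" "b \<in> L" for a b
  proof -
    have "2 \<in> K"
      using mem(5)[OF mem(4,4)] by simp
    with that show ?thesis
      unfolding h3_def prod.case using in_K L_subset by (intro mem(5-7,9)) auto
  qed
  show "a = 0 \<and> b = 0" if ab: "a \<in> L" "b \<in> L" "h3 (a, b) = 0" for a b
  proof -
    define y z where "y = a - \<iota> * a ^ q" and "z = \<iota> * \<omega> ^ q * b ^ q"
    have sum: "y + z = 0"
      using ab(3) two_nonzero nonzero by (simp add: h3_def y_def z_def)
    have "y \<in> L"
      unfolding y_def using ab(1) by (intro L_mem(6,7,9) \<iota>_in_L)
    moreover have "z ^ (q ^ 2) = - z"
      unfolding z_def using L_power[OF \<iota>_in_L] L_power[OF L_mem(9)[OF ab(2), of q]]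
      by (simp add: power_mult_distrib \<omega>q_conj)
    ultimately have diff: "y - z = 0"
      using fadd(1)[of y z 2] by (simp add: L_power sum zero_power_q2)
    then have "2 * y = 0"
      using sum by (simp add: algebra_simps)
    then have y: "y = 0"
      using two_nonzero by simp
    then have "b = 0"
      using diff nonzero by (simp add: z_def)
    have a: "a = \<iota> * a ^ q"
      using y by (simp add: y_def)
    have "a ^ q = \<iota> * a"
      using arg_cong[OF a, of "\<lambda>x. x ^ q"] L_power[OF ab(1)]
      by (simp add: power_mult_distrib \<iota>_fixed power_q_q)
    then have "a = \<iota> ^ 2 * a"
      using a by (simp add: power2_eq_square mult.assoc)
    then have "2 * a = 0"
      by (simp add: \<iota>_square eq_neg_iff_add_eq_0 flip: mult_2)
    then show ?thesis
      using two_nonzero \<open>b = 0\<close> by simp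
  qed
qed

definition bmul :: "'a \<Rightarrow> 'a \<Rightarrow> 'a" where
  "bmul x y = y ^ (q ^ 2) * x + y * x ^ (q ^ 2)
     - u ^ (q - 1) * (y ^ (q ^ 3) * x ^ (q ^ 3) + y ^ (q ^ 3) * x ^ (q ^ 3))"

text \<open>
  With $r = a c + j b^q d^q$ one has $r^q = a^q c^q - \iota \omega^2 b d$, because
  $b^{q^2} = b$ and $d^{q^2} = d$. Hence $r - \iota r^q$ collects the terms $a c - \omega^2 b d$ of
  the trace form as well as the terms
  $-\iota (a^q c^q + \omega^{2q} b^q d^q)$ of the twisted product.
\<close>

lemma product_formula:
  assumes P: "P \<in> L \<times> L" and Q: "Q \<in> L \<times> L"
  shows "bmul (h1 P) (h2 Q) = h3 (dmul P Q)"
proof -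
  obtain a b c d where PQ: "P = (a, b)" "Q = (c, d)"
    and L: "a \<in> L" "b \<in> L" "c \<in> L" "d \<in> L"
    using P Q by auto
  define X Y where "X = a + b * \<omega>" and "Y = c + d * \<omega>"
  note conj = pair_conj[OF L(1,2), folded X_def] pair_conj[OF L(3,4), folded Y_def]
  have \<kappa>3: "\<kappa> ^ (q ^ 3) = \<kappa> ^ q"
  proof -
    have "\<kappa> ^ (q ^ 3) = (\<kappa> ^ (q ^ 2)) ^ q"
      by (simp add: power3_eq_cube power2_eq_square flip: power_mult)
    then show ?thesis
      by (simp only: \<kappa>_fixed)
  qed
  have "bmul (\<mu> * X) (\<kappa> * \<mu> * Y) = \<kappa> * \<mu> ^ (q ^ 2) * \<mu> * (Y ^ (q ^ 2) * X + Y * X ^ (q ^ 2))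
      - 2 * (u ^ (q - 1) * \<kappa> ^ q * (\<mu> ^ (q ^ 3)) ^ 2) * (X ^ (q ^ 3) * Y ^ (q ^ 3))"
    unfolding bmul_def by (simp add: power_mult_distrib \<kappa>_fixed \<kappa>3 power2_eq_square[of "\<mu> ^ (q ^ 3)"] algebra_simps)
  also have "\<dots> = \<kappa> * \<mu> ^ (q ^ 2) * \<mu> * (Y ^ (q ^ 2) * X + Y * X ^ (q ^ 2)
      - 2 * \<iota> * (X ^ (q ^ 3) * Y ^ (q ^ 3)))"
    unfolding scaling_identity by (simp add: algebra_simps)
  finally have lhs: "bmul (\<mu> * X) (\<kappa> * \<mu> * Y) = \<dots>" .
  have \<iota>\<iota>: "\<iota> * (\<iota> * x) = - x" for x
    using \<iota>_square by (simp add: power2_eq_square flip: mult.assoc)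
  have rq: "(a * c + j * b ^ q * d ^ q) ^ q = a ^ q * c ^ q - \<iota> * \<omega> ^ 2 * b * d"
    using L by (simp add: power_q_add power_mult_distrib power_q_q L_power j_power_q)
  have tq: "(a * d + b * c) ^ q = a ^ q * d ^ q + b ^ q * c ^ q"
    by (simp add: power_q_add power_mult_distrib)
  have "Y ^ (q ^ 2) * X + Y * X ^ (q ^ 2) - 2 * \<iota> * (X ^ (q ^ 3) * Y ^ (q ^ 3))
      = 2 * (a * c + j * b ^ q * d ^ q - \<iota> * (a * c + j * b ^ q * d ^ q) ^ q
          + \<iota> * \<omega> ^ q * (a * d + b * c) ^ q)"
    unfolding rq tq conj unfolding X_def Y_def j_def
    by (simp add: algebra_simps power2_eq_square \<iota>\<iota>)
  then show ?thesis
    using lhs by (simp add: PQ h1_def h2_def h3_def dmul_def X_def Y_def mult_ac)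
qed

theorem isotopic_dickson: "isotopic (K, bmul) (L \<times> L, dmul)"
proof -
  obtain p e where pe: "prime p" "q = p ^ e"
    using q by (auto simp: primepow_def)
  have "CHAR('a) = p"
    using finite_field_CHAR[of K p "e * 4"] ff pe by (simp add: power_mult)
  then have "of_nat p = (0 :: 'a)"
    by auto
  then have char: "additive_characteristic p K" "additive_characteristic p (L \<times> L)"
    using pe by (auto simp: additive_characteristic_def sum_prod zero_prod_def)
  show ?thesis
  proof (rule isotopicI_inverse[OF char])
    show "dmul x y \<in> L \<times> L" if "x \<in> L \<times> L" "y \<in> L \<times> L" for x y
      using that j_in_L L_mem(5,7,9) by (auto simp: dmul_def)
    show "x + y \<in> L \<times> L" if "x \<in> L \<times> L" "y \<in> L \<times> L" for x y
      using that L_mem(5) by auto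
    show "h1 (x + y) = h1 x + h1 y" "h2 (x + y) = h2 x + h2 y" "h3 (x + y) = h3 x + h3 y" for x y
      by (cases x; cases y; simp add: h1_def h2_def h3_def power_q_add algebra_simps)+
  qed (fact mem(3) mem(5) bij_h1 bij_h2 bij_h3 product_formula)+
qed

end

lemma bierbrauer_order_q4_isotopic_dickson:
  fixes B :: "'a::field presemifield"
  assumes odd_q: "odd_prime_power q" and B: "bierbrauer_presemifield q 1 B"
  obtains D :: "('a \<times> 'a) presemifield" where "dickson_semifield D" "isotopic B D"
proof -
  obtain K n u v where K: "finite_field_of_order K (q ^ (4 * 1))" "primitive_element K u"
    and v: "v = u ^ (q ^ 1 - 1)" and n: "0 < n" "n < 4 * 1" "odd (2 * 1 div gcd (2 * 1) n)"
    and q_mod: "[q ^ 1 = 1] (mod 4)"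
    and B_eq: "B = (K, \<lambda>x y. y ^ (q ^ n) * x + y * x ^ (q ^ n)
                  - v * (y ^ (q ^ (1 + n)) * x ^ (q ^ (3 * 1))
                         + y ^ (q ^ (3 * 1)) * x ^ (q ^ (1 + n))))"
    using B unfolding bierbrauer_presemifield_def by (elim conjE exE) (rule that; assumption)
  interpret bierbrauer_field_4 K u q "q div 4"
    by unfold_locales
      (use K odd_q q_mod div_mult_mod_eq[of q 4] in \<open>auto simp: odd_prime_power_def cong_def\<close>)
  have "n \<in> {1, 2, 3}"
    using n by auto
  moreover have "gcd 2 3 = (1 :: nat)"
    by (simp add: coprime_iff_gcd_eq_1[symmetric])
  ultimately have "n = 2"
    using n(3) by auto
  then have "1 + n = 3" "n = 2"
    by simp_all
  then have "B = (K, bmul)"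
    unfolding B_eq v by (simp only: bmul_def fun_eq_iff prod.inject simp_thms power_one_right mult_1_right)
  then show ?thesis
    using that dickson_dmul[OF odd_q] isotopic_dickson by blast
qed

theorem corollary4p6:
  fixes q :: nat
  assumes "odd_prime_power q"
  shows
    "(\<forall>B :: 'a::field presemifield.
        bierbrauer_presemifield q 1 B \<longrightarrow>
        (\<exists>D :: ('a \<times> 'a) presemifield. dickson_semifield D \<and> isotopic B D)) \<and>
     (\<forall>m>1. odd m \<longrightarrow>
        (\<forall>B :: 'a presemifield.
           bierbrauer_presemifield q m B \<longrightarrow>
           (\<forall>D :: ('b::field \<times> 'b) presemifield. dickson_semifield D \<longrightarrow> \<not> isotopic B D) \<and>
           (\<forall>T :: 'b presemifield. generalized_twisted_field T \<longrightarrow> \<not> isotopic B T) \<and>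
           (\<forall>G :: ('b \<times> 'b) presemifield. ganley_semifield G \<longrightarrow> \<not> isotopic B G) \<and>
           (\<forall>G :: ('b \<times> 'b) presemifield. cohen_ganley_semifield G \<longrightarrow> \<not> isotopic B G) \<and>
           (\<forall>P :: 'b presemifield.
              coulter_matthews_ding_yuan_presemifield P \<longrightarrow> \<not> isotopic B P) \<and>
           (\<forall>P :: ('b \<times> 'b) presemifield. penttila_williams_semifield P \<longrightarrow> \<not> isotopic B P) \<and>
           (\<forall>P :: 'b presemifield.
              coulter_henderson_kosick_presemifield P \<longrightarrow> \<not> isotopic B P)))"
proof (intro conjI allI impI, goal_cases)
  case (1 B)
  then show ?case
    using assms by (metis bierbrauer_order_q4_isotopic_dickson)
next
  case (2 m B D)
  then show ?case
    by (metis bierbrauer_presemifieldE bierbrauer_field.not_isotopic_dickson)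
next
  case (3 m B T)
  then show ?case
    by (metis bierbrauer_presemifieldE bierbrauer_field.not_isotopic_generalized_twisted_field)
next
  case (4 m B G)
  then show ?case
    by (metis bierbrauer_presemifieldE bierbrauer_field.not_isotopic_ganley)
next
  case (5 m B G)
  then show ?case
    by (metis bierbrauer_presemifieldE bierbrauer_field.not_isotopic_cohen_ganley)
next
  case (6 m B P)
  then show ?case
    by (metis bierbrauer_presemifieldE bierbrauer_field.not_isotopic_coulter_matthews_ding_yuan)
next
  case (7 m B P)
  then show ?case
    by (metis bierbrauer_presemifieldE bierbrauer_field.not_isotopic_penttila_williams)
next
  case (8 m B P)
  then show ?case
    by (metis bierbrauer_presemifieldE bierbrauer_field.not_isotopic_coulter_henderson_kosick)
qed

end
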